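(* Let $(R,\mathfrak m)$ be a Cohen-Macaulay (commutative Noetherian) local ring of dimension $1$. Let $M$ be a (finitely generated) maximal Cohen-Macaulay $R$-module, and let $I$ be an $\mathfrak m$-primary ideal of $R$. Then $IM\cong M$ as $R$-modules if and only if $M\cong \operatorname{Hom}_R(I,M)$ as $R$-modules.
   Context: In the paper, a maximal Cohen-Macaulay module $M$ satisfying $IM\cong M$ is called $I$-Ulrich. *)

theory Defs
  imports "HOL-Algebra.Algebra" "HOL-Library.Extended_Nat"
begin

section \<open>Modules\<close>

definition ring_as_module :: "('a, 'c) ring_scheme \<Rightarrow> ('a, 'a) module" where
  "ring_as_module R =
     \<lparr>carrier = carrier R, monoid.mult = (\<otimes>\<^bsub>R\<^esub>), one = \<one>\<^bsub>R\<^esub>,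
      ring.zero = \<zero>\<^bsub>R\<^esub>, ring.add = (\<oplus>\<^bsub>R\<^esub>), smult = (\<otimes>\<^bsub>R\<^esub>)\<rparr>"

definition submodule_span ::
    "('a, 'c) ring_scheme \<Rightarrow> ('a, 'b, 'd) module_scheme \<Rightarrow> 'b set \<Rightarrow> 'b set" where
  "submodule_span R M S = \<Inter>{N. submodule N R M \<and> S \<subseteq> N}"

definition finitely_generated_module ::
    "('a, 'c) ring_scheme \<Rightarrow> ('a, 'b, 'd) module_scheme \<Rightarrow> bool" where
  "finitely_generated_module R M \<longleftrightarrow>
     (\<exists>A. finite A \<and> A \<subseteq> carrier M \<and> carrier M = submodule_span R M A)"

text \<open>The underlying set of \<open>I M\<close>; as a module, it is \<open>M\<lparr>carrier := ideal_smult R I M\<rparr>\<close>.\<close>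

definition ideal_smult ::
    "('a, 'c) ring_scheme \<Rightarrow> 'a set \<Rightarrow> ('a, 'b, 'd) module_scheme \<Rightarrow> 'b set" where
  "ideal_smult R I M = submodule_span R M {a \<odot>\<^bsub>M\<^esub> x | a x. a \<in> I \<and> x \<in> carrier M}"

text \<open>Homomorphisms are taken extensional (\<open>undefined\<close> outside the carrier of the domain), so
  that equality of functions is equality on that carrier.\<close>

definition linear_maps ::
    "('a, 'c) ring_scheme \<Rightarrow> ('a, 'b, 'd) module_scheme \<Rightarrow> ('a, 'e, 'f) module_scheme \<Rightarrow> ('b \<Rightarrow> 'e) set" where
  "linear_maps R M N =
     {f \<in> carrier M \<rightarrow>\<^sub>E carrier N.
        (\<forall>x\<in>carrier M. \<forall>y\<in>carrier M. f (x \<oplus>\<^bsub>M\<^esub> y) = f x \<oplus>\<^bsub>N\<^esub> f y) \<and>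
        (\<forall>a\<in>carrier R. \<forall>x\<in>carrier M. f (a \<odot>\<^bsub>M\<^esub> x) = a \<odot>\<^bsub>N\<^esub> f x)}"

text \<open>The ring fields \<open>mult\<close> and \<open>one\<close> of a module record carry no meaning.\<close>

definition Hom_module ::
    "('a, 'c) ring_scheme \<Rightarrow> ('a, 'b, 'd) module_scheme \<Rightarrow> ('a, 'e, 'f) module_scheme \<Rightarrow> ('a, 'b \<Rightarrow> 'e) module" where
  "Hom_module R M N =
     \<lparr>carrier = linear_maps R M N, monoid.mult = undefined, one = undefined,
      ring.zero = (\<lambda>x\<in>carrier M. \<zero>\<^bsub>N\<^esub>),
      ring.add = (\<lambda>f g. \<lambda>x\<in>carrier M. f x \<oplus>\<^bsub>N\<^esub> g x),
      smult = (\<lambda>a f. \<lambda>x\<in>carrier M. a \<odot>\<^bsub>N\<^esub> f x)\<rparr>"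

definition modules_isomorphic ::
    "('a, 'c) ring_scheme \<Rightarrow> ('a, 'b, 'd) module_scheme \<Rightarrow> ('a, 'e, 'f) module_scheme \<Rightarrow> bool" where
  "modules_isomorphic R M N \<longleftrightarrow>
     (\<exists>f\<in>linear_maps R M N. bij_betw f (carrier M) (carrier N))"


section \<open>Local rings, dimension and depth\<close>

definition local_ring :: "('a, 'c) ring_scheme \<Rightarrow> 'a set \<Rightarrow> bool" where
  "local_ring R \<mm> \<longleftrightarrow> cring R \<and> {J. maximalideal J R} = {\<mm>}"

definition krull_dim :: "('a, 'c) ring_scheme \<Rightarrow> enat" where
  "krull_dim R =
     Sup {enat n | n. \<exists>P :: nat \<Rightarrow> 'a set.
            (\<forall>i\<le>n. primeideal (P i) R) \<and> (\<forall>i<n. P i \<subset> P (Suc i))}"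

text \<open>The first condition says that \<open>xs ! i\<close> is a nonzerodivisor on \<open>M / (xs\<^sub>0, \<dots>, xs\<^sub>i\<^sub>-\<^sub>1) M\<close>.\<close>

definition regular_sequence ::
    "('a, 'c) ring_scheme \<Rightarrow> ('a, 'b, 'd) module_scheme \<Rightarrow> 'a list \<Rightarrow> bool" where
  "regular_sequence R M xs \<longleftrightarrow>
     set xs \<subseteq> carrier R \<and>
     (\<forall>i<length xs. \<forall>y\<in>carrier M.
        (xs ! i) \<odot>\<^bsub>M\<^esub> y \<in> ideal_smult R (Idl\<^bsub>R\<^esub> (set (take i xs))) M \<longrightarrow>
        y \<in> ideal_smult R (Idl\<^bsub>R\<^esub> (set (take i xs))) M) \<and>
     ideal_smult R (Idl\<^bsub>R\<^esub> (set xs)) M \<noteq> carrier M"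

definition depth ::
    "('a, 'c) ring_scheme \<Rightarrow> 'a set \<Rightarrow> ('a, 'b, 'd) module_scheme \<Rightarrow> enat" where
  "depth R \<mm> M =
     (if ideal_smult R \<mm> M = carrier M then \<infinity>
      else Sup {enat (length xs) | xs. set xs \<subseteq> \<mm> \<and> regular_sequence R M xs})"

definition cohen_macaulay_local_ring :: "('a, 'c) ring_scheme \<Rightarrow> 'a set \<Rightarrow> bool" where
  "cohen_macaulay_local_ring R \<mm> \<longleftrightarrow>
     noetherian_ring R \<and> local_ring R \<mm> \<and> depth R \<mm> (ring_as_module R) = krull_dim R"

text \<open>The zero module, whose depth is \<open>\<infinity>\<close>, counts as maximal Cohen-Macaulay.\<close>

definition maximal_cohen_macaulay ::
    "('a, 'c) ring_scheme \<Rightarrow> 'a set \<Rightarrow> ('a, 'b, 'd) module_scheme \<Rightarrow> bool" where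
  "maximal_cohen_macaulay R \<mm> M \<longleftrightarrow>
     module R M \<and> finitely_generated_module R M \<and>
     (carrier M = {\<zero>\<^bsub>M\<^esub>} \<or> depth R \<mm> M = krull_dim R)"


section \<open>Primary ideals\<close>

definition radical :: "('a, 'c) ring_scheme \<Rightarrow> 'a set \<Rightarrow> 'a set" where
  "radical R I = {a \<in> carrier R. \<exists>n::nat. a [^]\<^bsub>R\<^esub> n \<in> I}"

definition primary_ideal :: "('a, 'c) ring_scheme \<Rightarrow> 'a set \<Rightarrow> bool" where
  "primary_ideal R I \<longleftrightarrow>
     ideal I R \<and> I \<noteq> carrier R \<and>
     (\<forall>a\<in>carrier R. \<forall>b\<in>carrier R. a \<otimes>\<^bsub>R\<^esub> b \<in> I \<longrightarrow> a \<in> I \<or> b \<in> radical R I)"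

definition primary_to :: "('a, 'c) ring_scheme \<Rightarrow> 'a set \<Rightarrow> 'a set \<Rightarrow> bool" where
  "primary_to R \<pp> I \<longleftrightarrow> primary_ideal R I \<and> radical R I = \<pp>"


section \<open>The constructions are modules\<close>

lemma (in cring) ring_as_module_module: "module R (ring_as_module R)"
proof (rule moduleI)
  show "abelian_group (ring_as_module R)"
    by (rule abelian_groupI)
       (auto simp: ring_as_module_def a_ac intro: bexI[of _ "\<ominus> _"] l_neg)
qed (auto simp: ring_as_module_def l_distr r_distr m_assoc is_cring)

lemma (in module) submodule_span_submodule:
  assumes "S \<subseteq> carrier M"
  shows "submodule (submodule_span R M S) R M"
proof -
  have "\<zero>\<^bsub>M\<^esub> \<in> N" if "submodule N R M" for N
    using subgroup.one_closed[OF submodule.axioms(1)[OF that]] by simp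
  then show ?thesis
    using assms carrier_is_submodule
    by (intro submoduleI) (auto simp: submodule_span_def submoduleE(3,4,5))
qed

lemma (in module) ideal_smult_module:
  assumes "ideal I R"
  shows "module R (M\<lparr>carrier := ideal_smult R I M\<rparr>)"
  unfolding ideal_smult_def
  by (intro submodule.submodule_is_module submodule_span_submodule module_axioms)
     (use ideal.Icarr[OF assms] in auto)

lemma (in cring) ideal_as_module_module:
  assumes "ideal I R"
  shows "module R ((ring_as_module R)\<lparr>carrier := I\<rparr>)"
proof -
  interpret I: ideal I R by fact
  interpret S: module R "ring_as_module R" by (rule ring_as_module_module)
  have "\<ominus>\<^bsub>ring_as_module R\<^esub> a = \<ominus> a" for a
    by (simp add: a_inv_def m_inv_def ring_as_module_def)
  then have "submodule I R (ring_as_module R)"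
    by (intro S.submoduleI)
       (auto simp: ring_as_module_def I.I_l_closed dest: I.Icarr)
  then show ?thesis
    by (rule submodule.submodule_is_module) (rule ring_as_module_module)
qed

lemma Hom_module_module:
  assumes "module R M" "module R N"
  shows "module R (Hom_module R M N)"
proof -
  interpret M: module R M by fact
  interpret N: module R N by fact
  show ?thesis
  proof (rule moduleI)
    show "abelian_group (Hom_module R M N)"
    proof (rule abelian_groupI)
      fix f assume f: "f \<in> carrier (Hom_module R M N)"
      show "\<exists>g\<in>carrier (Hom_module R M N). g \<oplus>\<^bsub>Hom_module R M N\<^esub> f = \<zero>\<^bsub>Hom_module R M N\<^esub>"
        using f
        by (intro bexI[of _ "\<lambda>x\<in>carrier M. \<ominus>\<^bsub>N\<^esub> f x"])
           (auto simp: Hom_module_def linear_maps_def PiE_iff N.smult_r_minus N.minus_add N.l_neg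
                 intro!: restrict_ext)
    qed (auto simp: Hom_module_def linear_maps_def PiE_iff N.a_ac N.smult_r_distr
              intro!: restrict_ext extensionalityI[of _ "carrier M"])
  qed (auto simp: Hom_module_def linear_maps_def PiE_iff N.a_ac N.smult_r_distr N.smult_l_distr
          N.smult_assoc1[symmetric] M.R.m_comm M.R.is_cring
        intro!: restrict_ext extensionalityI[of _ "carrier M"])
qed

end

theory Submission
  imports Defs
begin

text \<open>
  Let \<open>c \<in> I\<close> be \<open>M\<close>-regular. Evaluation at \<open>c\<close> identifies \<open>Hom(I, M)\<close> with
  \<open>C = {y \<in> M. I y \<subseteq> c M}\<close>, so the two conditions say that some injective endomorphism of \<open>M\<close>
  has image \<open>I M\<close>, respectively \<open>C\<close>. Given \<open>\<phi>\<close> with image \<open>I M\<close>, the map \<open>\<theta> = \<phi>\<^sup>-\<^sup>1 c\<close> has image \<open>C\<close>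
  provided the commuting endomorphisms \<open>h\<^sub>a = \<phi>\<^sup>-\<^sup>1 a\<close> (\<open>a \<in> I\<close>) of \<open>M / c M\<close> have no common kernel;
  what is known is that their images generate \<open>M / c M\<close>. Given \<open>\<theta>\<close> with image \<open>C\<close>, the map
  \<open>\<phi> = \<theta>\<^sup>-\<^sup>1 c\<close> has image \<open>I M\<close> provided the images of the endomorphisms \<open>h\<^sub>a = c\<^sup>-\<^sup>1 a \<theta>\<close> of \<open>W / c M\<close>,
  where \<open>W = {u. \<theta> u \<in> c M}\<close>, generate; what is known is that they have no common kernel.
  In dimension one \<open>M / c M\<close> has finite length, and for commuting endomorphisms of a module of
  finite length the two properties are equivalent, by a Fitting type argument.
\<close>

section \<open>Primes and submodules\<close>

lemma (in noetherian_ring) maximal_ideal_of_family: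
  assumes "F \<noteq> {}" and "\<And>J. J \<in> F \<Longrightarrow> ideal J R"
  shows "\<exists>J\<in>F. \<forall>J'\<in>F. J \<subseteq> J' \<longrightarrow> J' = J"
proof (rule subset_Zorn_nonempty[OF assms(1)])
  fix C assume C: "C \<noteq> {}" "subset.chain F C"
  then have CF: "C \<subseteq> F" by (simp add: pred_on.chain_def)
  with C(2) assms(2) have "subset.chain {I. ideal I R} C"
    by (auto simp: pred_on.chain_def)
  then have "\<Union>C \<in> C" by (rule ideal_chain_is_trivial[OF C(1)])
  with CF show "\<Union>C \<in> F" by (rule subsetD)
qed

lemma (in cring) add_cgenideal:
  assumes "ideal P R" "a \<in> carrier R"
  shows "ideal (P <+>\<^bsub>R\<^esub> PIdl a) R" "P \<subseteq> P <+>\<^bsub>R\<^esub> PIdl a" "a \<in> P <+>\<^bsub>R\<^esub> PIdl a"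
proof -
  interpret P: ideal P R by fact
  interpret A: ideal "PIdl a" R by (rule cgenideal_ideal) fact
  show "ideal (P <+>\<^bsub>R\<^esub> PIdl a) R"
    by (rule add_ideals) (rule P.ideal_axioms A.ideal_axioms)+
  show "P \<subseteq> P <+>\<^bsub>R\<^esub> PIdl a"
  proof
    fix p assume p: "p \<in> P"
    then have "p = p \<oplus> \<zero>" using P.Icarr by simp
    with p A.zero_closed show "p \<in> P <+>\<^bsub>R\<^esub> PIdl a"
      unfolding set_add_def' by blast
  qed
  have "a = \<zero> \<oplus> a" using assms(2) by simp
  then show "a \<in> P <+>\<^bsub>R\<^esub> PIdl a"
    using P.zero_closed cgenideal_self[OF assms(2)] unfolding set_add_def' by blast
qed

text \<open>An ideal maximal among those that contain \<open>J\<close> and miss \<open>S\<close> is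
  prime: if neither a nor b lay in it, adjoining either one would meet \<open>S\<close>, and the
  product of the two meeting elements would lie both in \<open>S\<close> and in the ideal.\<close>

lemma prime_avoiding_multiplicative_set:
  fixes R (structure)
  assumes "noetherian_ring R" "cring R" "ideal J R" "S \<subseteq> carrier R" "\<one> \<in> S"
    and "\<And>s t. s \<in> S \<Longrightarrow> t \<in> S \<Longrightarrow> s \<otimes> t \<in> S" and "J \<inter> S = {}"
  shows "\<exists>P. primeideal P R \<and> J \<subseteq> P \<and> P \<inter> S = {}"
proof -
  interpret noetherian_ring R by fact
  interpret cring R by fact
  obtain P where P: "ideal P R" "J \<subseteq> P" "P \<inter> S = {}"
    and max: "\<And>Q. ideal Q R \<Longrightarrow> P \<subseteq> Q \<Longrightarrow> Q \<inter> S = {} \<Longrightarrow> Q = P"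
  proof -
    let ?F = "{Q. ideal Q R \<and> J \<subseteq> Q \<and> Q \<inter> S = {}}"
    have "J \<in> ?F" using assms(3,7) by simp
    then have "?F \<noteq> {}" by blast
    then have "\<exists>P\<in>?F. \<forall>Q\<in>?F. P \<subseteq> Q \<longrightarrow> Q = P"
      by (rule maximal_ideal_of_family) simp
    then obtain P where "P \<in> ?F" "\<forall>Q\<in>?F. P \<subseteq> Q \<longrightarrow> Q = P" by auto
    then show thesis by (intro that[of P]) auto
  qed
  interpret P: ideal P R by fact
  have meets: "\<exists>p\<in>P. \<exists>r\<in>carrier R. p \<oplus> r \<otimes> a \<in> S" if "a \<in> carrier R" "a \<notin> P" for a
  proof -
    have "(P <+>\<^bsub>R\<^esub> PIdl a) \<inter> S \<noteq> {}"
      using max[of "P <+>\<^bsub>R\<^esub> PIdl a"] add_cgenideal[OF P(1) that(1)] that(2) by blast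
    then show ?thesis unfolding set_add_def' cgenideal_def by auto
  qed
  have "primeideal P R"
  proof (rule primeidealI[OF P(1) assms(2)])
    show "carrier R \<noteq> P" using P(3) assms(5) by auto
    fix a b assume ab: "a \<in> carrier R" "b \<in> carrier R" "a \<otimes> b \<in> P"
    show "a \<in> P \<or> b \<in> P"
    proof (rule ccontr)
      assume "\<not> (a \<in> P \<or> b \<in> P)"
      then obtain p r q s where pr: "p \<in> P" "r \<in> carrier R" "p \<oplus> r \<otimes> a \<in> S"
        and qs: "q \<in> P" "s \<in> carrier R" "q \<oplus> s \<otimes> b \<in> S"
        using meets ab by meson
      note c = ab(1,2) pr(2) qs(2) P.Icarr[OF pr(1)] P.Icarr[OF qs(1)]
      have "(p \<oplus> r \<otimes> a) \<otimes> (q \<oplus> s \<otimes> b)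
          = p \<otimes> (q \<oplus> s \<otimes> b) \<oplus> ((r \<otimes> a) \<otimes> q \<oplus> (r \<otimes> s) \<otimes> (a \<otimes> b))"
        using c by algebra
      also have "\<dots> \<in> P"
        using c pr(1) qs(1) ab(3) by (simp add: P.I_l_closed P.I_r_closed)
      finally show False using assms(6)[OF pr(3) qs(3)] P(3) by blast
    qed
  qed
  with P show ?thesis by blast
qed

text \<open>\<open>local_ring\<close> only says which ideal is maximal; that \<open>J\<close> lies
  below a maximal ideal at all comes from a maximal choice among the proper ideals above
  \<open>J\<close>.\<close>

lemma local_ring_proper_ideal:
  assumes "noetherian_ring R" "local_ring R \<mm>" "ideal J R" "J \<noteq> carrier R"
  shows "J \<subseteq> \<mm>"
proof -
  interpret noetherian_ring R by fact
  obtain P where P: "ideal P R" "J \<subseteq> P" "P \<noteq> carrier R"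
    and max: "\<And>Q. ideal Q R \<Longrightarrow> P \<subseteq> Q \<Longrightarrow> Q \<noteq> carrier R \<Longrightarrow> Q = P"
  proof -
    let ?F = "{Q. ideal Q R \<and> J \<subseteq> Q \<and> Q \<noteq> carrier R}"
    have "J \<in> ?F" using assms(3,4) by simp
    then have "?F \<noteq> {}" by blast
    then have "\<exists>P\<in>?F. \<forall>Q\<in>?F. P \<subseteq> Q \<longrightarrow> Q = P"
      by (rule maximal_ideal_of_family) simp
    then obtain P where "P \<in> ?F" "\<forall>Q\<in>?F. P \<subseteq> Q \<longrightarrow> Q = P" by auto
    then show thesis by (intro that[of P]) auto
  qed
  have "maximalideal P R"
    using P(3) max by (intro maximalidealI[OF P(1)]) auto
  with assms(2) P(2) show ?thesis unfolding local_ring_def by blast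
qed

lemma local_ring_unit:
  fixes R (structure)
  assumes "noetherian_ring R" "local_ring R \<mm>" "r \<in> carrier R" "r \<notin> \<mm>"
  shows "\<exists>s\<in>carrier R. s \<otimes> r = \<one>"
proof -
  interpret cring R using assms(2) by (simp add: local_ring_def)
  have "PIdl r = carrier R"
    using local_ring_proper_ideal[OF assms(1,2) cgenideal_ideal[OF assms(3)]]
      cgenideal_self[OF assms(3)] assms(4) by blast
  then have "\<one> \<in> PIdl r" by simp
  then show ?thesis unfolding cgenideal_def by force
qed

lemma krull_dim_ge_two:
  assumes "primeideal P R" "primeideal Q R" "primeideal T R" "P \<subset> Q" "Q \<subset> T"
  shows "krull_dim R \<ge> 2"
proof -
  \<comment> \<open>\<open>krull_dim\<close> counts strict inclusions, so three primes at the
    indices 0, 1, 2 witness the value two.\<close>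
  define C where "C i = (if i = 0 then P else if i = 1 then Q else T)" for i :: nat
  have "(\<forall>i\<le>2. primeideal (C i) R) \<and> (\<forall>i<2. C i \<subset> C (Suc i))"
    using assms by (auto simp: C_def less_2_cases_iff)
  then have "enat 2 \<le> krull_dim R"
    unfolding krull_dim_def by (intro Sup_upper) blast
  then show ?thesis by (simp add: numeral_eq_enat)
qed

section \<open>Submodules and endomorphisms\<close>

lemma (in module) submodule_zero: "submodule N R M \<Longrightarrow> \<zero>\<^bsub>M\<^esub> \<in> N"
  by (drule submodule.axioms(1)) (use subgroup.one_closed in fastforce)

lemma (in module) submodule_minus:
  assumes "submodule N R M" "x \<in> N" "y \<in> N"
  shows "x \<ominus>\<^bsub>M\<^esub> y \<in> N"
  using assms by (simp add: a_minus_def submoduleE(3,5)[OF assms(1)])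

lemma (in module) submodule_inter:
  assumes "submodule N R M" "submodule N' R M"
  shows "submodule (N \<inter> N') R M"
proof (rule submoduleI)
  show "N \<inter> N' \<subseteq> carrier M" using submoduleE(1)[OF assms(1)] by blast
qed (simp_all add: assms submodule_zero submoduleE(3-5))

lemma set_addI: "x \<in> A \<Longrightarrow> y \<in> B \<Longrightarrow> x \<oplus>\<^bsub>G\<^esub> y \<in> A <+>\<^bsub>G\<^esub> B"
  unfolding set_add_def' by blast

lemma (in module) submodule_add:
  assumes N: "submodule N R M" and N': "submodule N' R M"
  shows "submodule (N <+>\<^bsub>M\<^esub> N') R M"
proof (rule submoduleI)
  note c = submoduleE(1)[OF N, THEN subsetD] submoduleE(1)[OF N', THEN subsetD]
  show "N <+>\<^bsub>M\<^esub> N' \<subseteq> carrier M" using c by (auto simp: set_add_def')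
  have "\<zero>\<^bsub>M\<^esub> = \<zero>\<^bsub>M\<^esub> \<oplus>\<^bsub>M\<^esub> \<zero>\<^bsub>M\<^esub>" by simp
  then show "\<zero>\<^bsub>M\<^esub> \<in> N <+>\<^bsub>M\<^esub> N'"
    using submodule_zero[OF N] submodule_zero[OF N'] unfolding set_add_def' by blast
next
  note c = submoduleE(1)[OF N, THEN subsetD] submoduleE(1)[OF N', THEN subsetD]
  fix x y assume x: "x \<in> N <+>\<^bsub>M\<^esub> N'" and y: "y \<in> N <+>\<^bsub>M\<^esub> N'"
  obtain a b where x: "a \<in> N" "b \<in> N'" "x = a \<oplus>\<^bsub>M\<^esub> b" using x by (auto simp: set_add_def')
  obtain a' b' where y: "a' \<in> N" "b' \<in> N'" "y = a' \<oplus>\<^bsub>M\<^esub> b'" using y by (auto simp: set_add_def')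
  have "\<ominus>\<^bsub>M\<^esub> x = (\<ominus>\<^bsub>M\<^esub> a) \<oplus>\<^bsub>M\<^esub> (\<ominus>\<^bsub>M\<^esub> b)" using x c by (simp add: M.minus_add)
  then show "\<ominus>\<^bsub>M\<^esub> x \<in> N <+>\<^bsub>M\<^esub> N'"
    using x submoduleE(3)[OF N] submoduleE(3)[OF N'] by (simp add: set_addI)
  have "x \<oplus>\<^bsub>M\<^esub> y = (a \<oplus>\<^bsub>M\<^esub> a') \<oplus>\<^bsub>M\<^esub> (b \<oplus>\<^bsub>M\<^esub> b')" using x y c by (simp add: M.a_ac)
  then show "x \<oplus>\<^bsub>M\<^esub> y \<in> N <+>\<^bsub>M\<^esub> N'"
    using x(1,2) y(1,2) submoduleE(5)[OF N] submoduleE(5)[OF N'] by (simp only: set_addI)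
next
  note c = submoduleE(1)[OF N, THEN subsetD] submoduleE(1)[OF N', THEN subsetD]
  fix r x assume r: "r \<in> carrier R" and x: "x \<in> N <+>\<^bsub>M\<^esub> N'"
  obtain a b where x: "a \<in> N" "b \<in> N'" "x = a \<oplus>\<^bsub>M\<^esub> b" using x by (auto simp: set_add_def')
  have "r \<odot>\<^bsub>M\<^esub> x = (r \<odot>\<^bsub>M\<^esub> a) \<oplus>\<^bsub>M\<^esub> (r \<odot>\<^bsub>M\<^esub> b)" using r x c by (simp add: smult_r_distr)
  then show "r \<odot>\<^bsub>M\<^esub> x \<in> N <+>\<^bsub>M\<^esub> N'"
    using r x(1,2) submoduleE(4)[OF N] submoduleE(4)[OF N'] by (simp only: set_addI)
qed

lemma (in module) submodule_add_upper:
  assumes "submodule N R M" "submodule N' R M"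
  shows "N \<subseteq> N <+>\<^bsub>M\<^esub> N'" "N' \<subseteq> N <+>\<^bsub>M\<^esub> N'"
proof -
  note c = submoduleE(1)[OF assms(1), THEN subsetD] submoduleE(1)[OF assms(2), THEN subsetD]
  show "N \<subseteq> N <+>\<^bsub>M\<^esub> N'"
    using c submodule_zero[OF assms(2)] by (force simp: set_add_def')
  show "N' \<subseteq> N <+>\<^bsub>M\<^esub> N'"
    using c submodule_zero[OF assms(1)] by (force simp: set_add_def')
qed

lemma (in module) submodule_add_least:
  assumes "submodule T R M" "N \<subseteq> T" "N' \<subseteq> T"
  shows "N <+>\<^bsub>M\<^esub> N' \<subseteq> T"
  using assms submoduleE(5)[OF assms(1)] by (auto simp: set_add_def')

text \<open>Unlike \<open>linear_maps\<close>, this leaves the values outside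
  \<open>carrier M\<close> free, so that multiplication by a ring element and composites are
  endomorphisms without being restricted first.\<close>

definition module_endo :: "('a, 'c) ring_scheme \<Rightarrow> ('a, 'b, 'd) module_scheme \<Rightarrow> ('b \<Rightarrow> 'b) \<Rightarrow> bool" where
  "module_endo R M f \<longleftrightarrow> f \<in> carrier M \<rightarrow> carrier M \<and>
     (\<forall>x\<in>carrier M. \<forall>y\<in>carrier M. f (x \<oplus>\<^bsub>M\<^esub> y) = f x \<oplus>\<^bsub>M\<^esub> f y) \<and>
     (\<forall>a\<in>carrier R. \<forall>x\<in>carrier M. f (a \<odot>\<^bsub>M\<^esub> x) = a \<odot>\<^bsub>M\<^esub> f x)"

lemma (in module) module_endoD:
  assumes "module_endo R M f"
  shows "x \<in> carrier M \<Longrightarrow> f x \<in> carrier M"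
    and "x \<in> carrier M \<Longrightarrow> y \<in> carrier M \<Longrightarrow> f (x \<oplus>\<^bsub>M\<^esub> y) = f x \<oplus>\<^bsub>M\<^esub> f y"
    and "a \<in> carrier R \<Longrightarrow> x \<in> carrier M \<Longrightarrow> f (a \<odot>\<^bsub>M\<^esub> x) = a \<odot>\<^bsub>M\<^esub> f x"
    and "f \<zero>\<^bsub>M\<^esub> = \<zero>\<^bsub>M\<^esub>"
    and "x \<in> carrier M \<Longrightarrow> f (\<ominus>\<^bsub>M\<^esub> x) = \<ominus>\<^bsub>M\<^esub> f x"
    and "x \<in> carrier M \<Longrightarrow> y \<in> carrier M \<Longrightarrow> f (x \<ominus>\<^bsub>M\<^esub> y) = f x \<ominus>\<^bsub>M\<^esub> f y"
proof -
  show cl: "f x \<in> carrier M" if "x \<in> carrier M" for x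
    using that assms by (auto simp: module_endo_def)
  show ad: "f (x \<oplus>\<^bsub>M\<^esub> y) = f x \<oplus>\<^bsub>M\<^esub> f y" if "x \<in> carrier M" "y \<in> carrier M" for x y
    using that assms by (auto simp: module_endo_def)
  show sm: "f (a \<odot>\<^bsub>M\<^esub> x) = a \<odot>\<^bsub>M\<^esub> f x" if "a \<in> carrier R" "x \<in> carrier M" for a x
    using that assms by (auto simp: module_endo_def)
  show "f \<zero>\<^bsub>M\<^esub> = \<zero>\<^bsub>M\<^esub>"
    using sm[of \<zero> "\<zero>\<^bsub>M\<^esub>"] cl[of "\<zero>\<^bsub>M\<^esub>"] by simp
  show mi: "f (\<ominus>\<^bsub>M\<^esub> x) = \<ominus>\<^bsub>M\<^esub> f x" if "x \<in> carrier M" for x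
    using sm[of "\<ominus> \<one>" x] cl[of x] that by (simp add: smult_l_minus)
  show "f (x \<ominus>\<^bsub>M\<^esub> y) = f x \<ominus>\<^bsub>M\<^esub> f y" if "x \<in> carrier M" "y \<in> carrier M" for x y
    using that by (simp add: a_minus_def ad mi)
qed

lemma (in module) smult_endo:
  assumes "c \<in> carrier R"
  shows "module_endo R M ((\<odot>\<^bsub>M\<^esub>) c)"
  using assms by (simp add: module_endo_def smult_r_distr smult_assoc1[symmetric] R.m_comm)

lemma (in module) endo_image_submodule:
  assumes f: "module_endo R M f" and N: "submodule N R M"
  shows "submodule (f ` N) R M"
proof (rule submoduleI)
  note c = submoduleE(1)[OF N, THEN subsetD]
  show "f ` N \<subseteq> carrier M" using c module_endoD(1)[OF f] by auto
  show "\<zero>\<^bsub>M\<^esub> \<in> f ` N"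
    using module_endoD(4)[OF f] submodule_zero[OF N] by (metis imageI)
  show "\<ominus>\<^bsub>M\<^esub> x \<in> f ` N" if "x \<in> f ` N" for x
    using that c submoduleE(3)[OF N] by (auto simp: module_endoD(5)[OF f, symmetric])
  show "x \<oplus>\<^bsub>M\<^esub> y \<in> f ` N" if "x \<in> f ` N" "y \<in> f ` N" for x y
    using that c submoduleE(5)[OF N] by (auto simp: module_endoD(2)[OF f, symmetric])
  show "a \<odot>\<^bsub>M\<^esub> x \<in> f ` N" if "a \<in> carrier R" "x \<in> f ` N" for a x
    using that c submoduleE(4)[OF N] by (auto simp: module_endoD(3)[OF f, symmetric])
qed

lemma (in module) endo_preimage_submodule:
  assumes f: "module_endo R M f" and "submodule W R M" "submodule N R M"
  shows "submodule {w \<in> W. f w \<in> N} R M"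
proof -
  note c = submoduleE(1)[OF assms(2), THEN subsetD]
  show ?thesis
    using assms c
    by (intro submoduleI)
      (auto simp: module_endoD(2-5)[OF f] submodule_zero submoduleE(3-5))
qed

text \<open>Used for annihilators in M / N: of the whole quotient when \<open>A = carrier M\<close>,
  of the class of one element when \<open>A\<close> is a singleton.\<close>

lemma (in module) submodule_colon_ideal:
  assumes N: "submodule N R M" and A: "A \<subseteq> carrier M"
  shows "ideal {r \<in> carrier R. \<forall>x\<in>A. r \<odot>\<^bsub>M\<^esub> x \<in> N} R"
proof (rule idealI)
  note c = A[THEN subsetD]
  show "subgroup {r \<in> carrier R. \<forall>x\<in>A. r \<odot>\<^bsub>M\<^esub> x \<in> N} (add_monoid R)"
    using c submoduleE(3,5)[OF N] submodule_zero[OF N]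
    by (intro R.add.subgroupI) (auto simp: smult_l_minus smult_l_distr intro: exI[of _ \<zero>])
  fix r t assume r: "r \<in> {r \<in> carrier R. \<forall>x\<in>A. r \<odot>\<^bsub>M\<^esub> x \<in> N}" and t: "t \<in> carrier R"
  from r t c submoduleE(4)[OF N t]
  show "t \<otimes> r \<in> {r \<in> carrier R. \<forall>x\<in>A. r \<odot>\<^bsub>M\<^esub> x \<in> N}"
    by (auto simp: smult_assoc1)
  with t r show "r \<otimes> t \<in> {r \<in> carrier R. \<forall>x\<in>A. r \<odot>\<^bsub>M\<^esub> x \<in> N}"
    by (simp add: R.m_comm)
qed (rule R.ring_axioms)

lemma (in module) smult_image_submodule:
  "c \<in> carrier R \<Longrightarrow> submodule ((\<odot>\<^bsub>M\<^esub>) c ` carrier M) R M"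
  by (intro endo_image_submodule smult_endo carrier_is_submodule)

section \<open>Nilpotency of the maximal ideal modulo a regular element\<close>

lemma (in module) nat_pow_regular:
  assumes "c \<in> carrier R" "\<And>x. x \<in> carrier M \<Longrightarrow> c \<odot>\<^bsub>M\<^esub> x = \<zero>\<^bsub>M\<^esub> \<Longrightarrow> x = \<zero>\<^bsub>M\<^esub>"
    and "x \<in> carrier M" "(c [^] (k::nat)) \<odot>\<^bsub>M\<^esub> x = \<zero>\<^bsub>M\<^esub>"
  shows "x = \<zero>\<^bsub>M\<^esub>"
  using assms(4)
proof (induction k)
  case 0
  with assms(3) show ?case by simp
next
  case (Suc k)
  have "c \<odot>\<^bsub>M\<^esub> ((c [^] k) \<odot>\<^bsub>M\<^esub> x) = \<zero>\<^bsub>M\<^esub>"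
    using Suc.prems assms(1,3) by (simp add: smult_assoc1[symmetric] R.m_comm)
  then have "(c [^] k) \<odot>\<^bsub>M\<^esub> x = \<zero>\<^bsub>M\<^esub>"
    by (rule assms(2)[rotated]) (use assms(1,3) in simp)
  then show ?case by (rule Suc.IH)
qed

text \<open>In dimension one, a prime containing \<open>c\<close> and \<open>Ann M\<close> but different from \<open>\<mm>\<close> would be
  minimal, so some \<open>c\<^sup>k s\<close> with \<open>s\<close> outside it would vanish, forcing \<open>s \<in> Ann M\<close>.\<close>

lemma (in module) maximal_ideal_nilpotent_mod_regular:
  assumes "noetherian_ring R" "local_ring R \<mm>" "krull_dim R = 1" "c \<in> \<mm>"
    and reg: "\<And>x. x \<in> carrier M \<Longrightarrow> c \<odot>\<^bsub>M\<^esub> x = \<zero>\<^bsub>M\<^esub> \<Longrightarrow> x = \<zero>\<^bsub>M\<^esub>"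
    and a: "a \<in> \<mm>"
  shows "\<exists>k::nat. \<forall>x\<in>carrier M. (a [^] k) \<odot>\<^bsub>M\<^esub> x \<in> (\<odot>\<^bsub>M\<^esub>) c ` carrier M"
proof (rule ccontr)
  assume neg: "\<not> ?thesis"
  have "\<mm> \<in> {J. maximalideal J R}" using assms(2) unfolding local_ring_def by simp
  then have max: "maximalideal \<mm> R" by simp
  then interpret m: maximalideal \<mm> R .
  have c: "c \<in> carrier R" and ac: "a \<in> carrier R" using assms(4) a m.Icarr by auto
  \<comment> \<open>\<open>J\<close> is the annihilator of M / c M. It contains c and Ann M; if the
    claim fails it misses all powers of a, so some prime above it misses them too.\<close>
  define J where "J = {r \<in> carrier R. \<forall>x\<in>carrier M. r \<odot>\<^bsub>M\<^esub> x \<in> (\<odot>\<^bsub>M\<^esub>) c ` carrier M}"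
  have J: "ideal J R"
    unfolding J_def by (rule submodule_colon_ideal[OF smult_image_submodule[OF c]]) simp
  have cJ: "c \<in> J" using c by (auto simp: J_def)
  have "\<exists>P. primeideal P R \<and> J \<subseteq> P \<and> P \<inter> range (\<lambda>k::nat. a [^] k) = {}"
  proof (rule prime_avoiding_multiplicative_set[OF assms(1) R.is_cring J])
    show "\<one> \<in> range (\<lambda>k::nat. a [^] k)" by (rule range_eqI[of _ _ 0]) simp
    show "J \<inter> range (\<lambda>k::nat. a [^] k) = {}" using neg by (auto simp: J_def)
    show "s \<otimes> t \<in> range (\<lambda>k::nat. a [^] k)"
      if st: "s \<in> range (\<lambda>k::nat. a [^] k)" "t \<in> range (\<lambda>k::nat. a [^] k)" for s t
    proof -
      obtain k l where "s = a [^] (k::nat)" "t = a [^] (l::nat)" using st by blast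
      then show ?thesis using R.nat_pow_mult[OF ac] by simp
    qed
    show "range (\<lambda>k::nat. a [^] k) \<subseteq> carrier R" using ac by auto
  qed
  then obtain P where P: "primeideal P R" "J \<subseteq> P" and "P \<inter> range (\<lambda>k::nat. a [^] k) = {}"
    by auto
  then have aP: "a [^] k \<notin> P" for k :: nat by blast
  interpret P: primeideal P R by fact
  have "a \<notin> P" using aP[of 1] ac by simp
  have "P \<subseteq> \<mm>"
    using P.I_notcarr by (intro local_ring_proper_ideal[OF assms(1,2) P.ideal_axioms]) simp
  with a \<open>a \<notin> P\<close> have "P \<subset> \<mm>" by blast
  \<comment> \<open>A prime that misses \<open>T\<close> lies inside \<open>P\<close> (take k = 0)
    and does not contain c (take k = 1 and s = 1), so it lies strictly below
    \<open>P\<close>.\<close>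
  define T where "T = {(c [^] k) \<otimes> s | (k::nat) s. s \<in> carrier R - P}"
  have oneP: "\<one> \<notin> P" using P.one_imp_carrier P.I_notcarr by blast
  have "\<exists>P'. primeideal P' R \<and> {\<zero>} \<subseteq> P' \<and> P' \<inter> T = {}"
  proof (rule prime_avoiding_multiplicative_set[OF assms(1) R.is_cring R.zeroideal])
    show "T \<subseteq> carrier R" using c by (auto simp: T_def)
    show "\<one> \<in> T"
      unfolding T_def using oneP by (intro CollectI exI[of _ "0::nat"] exI[of _ \<one>]) simp
    show "s \<otimes> t \<in> T" if st: "s \<in> T" "t \<in> T" for s t
    proof -
      obtain k s' l t' where *: "s = (c [^] (k::nat)) \<otimes> s'" "t = (c [^] (l::nat)) \<otimes> t'"
        "s' \<in> carrier R - P" "t' \<in> carrier R - P" using st by (auto simp: T_def)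
      then have "s \<otimes> t = (c [^] (k + l)) \<otimes> (s' \<otimes> t')"
        using c by (simp add: R.nat_pow_mult[symmetric] R.m_ac)
      moreover have "s' \<otimes> t' \<in> carrier R - P" using *(3,4) P.I_prime[of s' t'] by auto
      ultimately show ?thesis unfolding T_def by blast
    qed
    show "{\<zero>} \<inter> T = {}"
    proof (rule ccontr)
      assume "{\<zero>} \<inter> T \<noteq> {}"
      then obtain k s where ks: "(c [^] (k::nat)) \<otimes> s = \<zero>" "s \<in> carrier R" "s \<notin> P"
        by (auto simp: T_def)
      have "s \<odot>\<^bsub>M\<^esub> x = \<zero>\<^bsub>M\<^esub>" if x: "x \<in> carrier M" for x
      proof (rule nat_pow_regular[OF c])
        show "(c [^] k) \<odot>\<^bsub>M\<^esub> (s \<odot>\<^bsub>M\<^esub> x) = \<zero>\<^bsub>M\<^esub>"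
          using ks x c by (simp add: smult_assoc1[symmetric])
        show "s \<odot>\<^bsub>M\<^esub> x \<in> carrier M" using ks x by simp
      qed (rule reg)
      then have "s \<in> J"
        using ks(2) submodule_zero[OF smult_image_submodule[OF c]] by (simp add: J_def)
      with P(2) ks(3) show False by blast
    qed
  qed
  then obtain P' where P': "primeideal P' R" "P' \<inter> T = {}" by auto
  interpret P': primeideal P' R by fact
  have sub: "P' \<subseteq> P"
  proof
    fix s assume s: "s \<in> P'"
    show "s \<in> P"
    proof (rule ccontr)
      assume "s \<notin> P"
      then have "(c [^] (0::nat)) \<otimes> s \<in> T" using P'.Icarr[OF s] unfolding T_def by blast
      then have "s \<in> T" using P'.Icarr[OF s] by simp
      then show False using P'(2) s by blast
    qed
  qed
  have "(c [^] (1::nat)) \<otimes> \<one> \<in> T" unfolding T_def using oneP by blast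
  then have "c \<in> T" using c by simp
  then have "c \<notin> P'" using P'(2) by blast
  then have "P' \<subset> P" using sub cJ P(2) by blast
  then have "krull_dim R \<ge> 2"
    using \<open>P \<subset> \<mm>\<close> by (rule krull_dim_ge_two[OF P'(1) P(1) R.maximalideal_prime[OF max]])
  with assms(3) show False by simp
qed


section \<open>Finite length\<close>

text \<open>Only a strictly monotone function on the submodules between \<open>K\<close> and \<open>L\<close> is required, not the
  additivity of the actual length of \<open>L / K\<close>.\<close>

definition strict_length ::
    "('a, 'c) ring_scheme \<Rightarrow> ('a, 'b, 'd) module_scheme \<Rightarrow> 'b set \<Rightarrow> 'b set \<Rightarrow> ('b set \<Rightarrow> nat) \<Rightarrow> bool" where
  "strict_length R M K L len \<longleftrightarrow>
     (\<forall>U V. submodule U R M \<longrightarrow> submodule V R M \<longrightarrow> K \<subseteq> U \<longrightarrow> U \<subset> V \<longrightarrow> V \<subseteq> L \<longrightarrow> len U < len V)"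

lemma (in module) singleton_span_submodule:
  assumes "e \<in> carrier M"
  shows "submodule {r \<odot>\<^bsub>M\<^esub> e | r. r \<in> carrier R} R M"
proof (rule submoduleI)
  show "\<zero>\<^bsub>M\<^esub> \<in> {r \<odot>\<^bsub>M\<^esub> e | r. r \<in> carrier R}"
    using assms by (intro CollectI exI[of _ \<zero>]) simp
  show "\<ominus>\<^bsub>M\<^esub> x \<in> {r \<odot>\<^bsub>M\<^esub> e | r. r \<in> carrier R}" if x: "x \<in> {r \<odot>\<^bsub>M\<^esub> e | r. r \<in> carrier R}" for x
  proof -
    obtain r where "x = r \<odot>\<^bsub>M\<^esub> e" "r \<in> carrier R" using x by blast
    then show ?thesis using assms by (intro CollectI exI[of _ "\<ominus> r"]) (simp add: smult_l_minus)
  qed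
  show "x \<oplus>\<^bsub>M\<^esub> y \<in> {r \<odot>\<^bsub>M\<^esub> e | r. r \<in> carrier R}"
    if xy: "x \<in> {r \<odot>\<^bsub>M\<^esub> e | r. r \<in> carrier R}" "y \<in> {r \<odot>\<^bsub>M\<^esub> e | r. r \<in> carrier R}" for x y
  proof -
    obtain r s where "x = r \<odot>\<^bsub>M\<^esub> e" "r \<in> carrier R" "y = s \<odot>\<^bsub>M\<^esub> e" "s \<in> carrier R" using xy by blast
    then show ?thesis using assms by (intro CollectI exI[of _ "r \<oplus> s"]) (simp add: smult_l_distr)
  qed
  show "a \<odot>\<^bsub>M\<^esub> x \<in> {r \<odot>\<^bsub>M\<^esub> e | r. r \<in> carrier R}"
    if a: "a \<in> carrier R" and x: "x \<in> {r \<odot>\<^bsub>M\<^esub> e | r. r \<in> carrier R}" for a x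
  proof -
    obtain r where "x = r \<odot>\<^bsub>M\<^esub> e" "r \<in> carrier R" using x by blast
    then show ?thesis using assms a by (intro CollectI exI[of _ "a \<otimes> r"]) (simp add: smult_assoc1)
  qed
qed (use assms in auto)

text \<open>The enlarged submodule modulo \<open>L\<close> is zero or simple, being generated by one
  element killed by \<open>\<mm>\<close>. Accordingly \<open>len'\<close> adds one to the length
  inside \<open>L\<close> exactly for the submodules that leave \<open>L\<close>.\<close>

lemma (in module) strict_length_extend_simple:
  assumes "noetherian_ring R" "local_ring R \<mm>" "submodule L R M" "K \<subseteq> L"
    and len: "strict_length R M K L len" and e: "e \<in> carrier M"
    and simple: "\<And>a. a \<in> \<mm> \<Longrightarrow> a \<odot>\<^bsub>M\<^esub> e \<in> L"
  shows "\<exists>len'. strict_length R M K (L <+>\<^bsub>M\<^esub> {r \<odot>\<^bsub>M\<^esub> e | r. r \<in> carrier R}) len'"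
proof (intro exI)
  define E where "E = {r \<odot>\<^bsub>M\<^esub> e | r. r \<in> carrier R}"
  define len' where "len' U = len (U \<inter> L) + (if U \<subseteq> L then 0 else 1)" for U
  have Lc: "l \<in> carrier M" if "l \<in> L" for l using that submoduleE(1)[OF assms(3)] by blast
  have "len' U < len' V"
    if U: "submodule U R M" and V: "submodule V R M" and KX: "K \<subseteq> U" and XY: "U \<subset> V"
      and YL: "V \<subseteq> L <+>\<^bsub>M\<^esub> E" for U V
  proof (cases "U \<inter> L = V \<inter> L")
    case False
    then have "U \<inter> L \<subset> V \<inter> L" using XY by blast
    then have "len (U \<inter> L) < len (V \<inter> L)"
      using len submodule_inter[OF U assms(3)] submodule_inter[OF V assms(3)] KX assms(4)
      unfolding strict_length_def by (meson Int_greatest Int_lower2)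
    moreover have "V \<subseteq> L \<Longrightarrow> U \<subseteq> L" using XY by blast
    ultimately show ?thesis unfolding len'_def by simp
  next
    case True
    have YnL: "\<not> V \<subseteq> L" using True XY by blast
    \<comment> \<open>If \<open>U\<close> left \<open>L\<close>, it would contain some l + r e with
      r a unit. Subtracting multiples of this element moves every element of \<open>V\<close> into
      \<open>V \<inter> L = U \<inter> L\<close>, so \<open>V\<close> would be contained in
      \<open>U\<close>.\<close>
    have "U \<subseteq> L"
    proof (rule ccontr)
      assume "\<not> U \<subseteq> L"
      then obtain x where x: "x \<in> U" "x \<notin> L" by blast
      have xc: "x \<in> carrier M" using x U submoduleE(1) by blast
      have "x \<in> L <+>\<^bsub>M\<^esub> E" using x XY YL by blast
      then obtain l r where lr: "l \<in> L" "r \<in> carrier R" "x = l \<oplus>\<^bsub>M\<^esub> r \<odot>\<^bsub>M\<^esub> e"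
        unfolding set_add_def' E_def by blast
      have "r \<notin> \<mm>" using lr x simple submoduleE(5)[OF assms(3)] by blast
      then obtain s where s: "s \<in> carrier R" "s \<otimes> r = \<one>"
        using local_ring_unit[OF assms(1,2) lr(2)] by blast
      have "V \<subseteq> U"
      proof
        fix y assume y: "y \<in> V"
        then have "y \<in> L <+>\<^bsub>M\<^esub> E" using YL by blast
        then obtain l' t where lt: "l' \<in> L" "t \<in> carrier R" "y = l' \<oplus>\<^bsub>M\<^esub> t \<odot>\<^bsub>M\<^esub> e"
          unfolding set_add_def' E_def by blast
        \<comment> \<open>With this factor, \<open>u x\<close> has the same e-component as
          \<open>y\<close>, so that \<open>y - u x\<close> lies in \<open>L\<close>.\<close>
        define u where "u = t \<otimes> s"
        have u: "u \<in> carrier R" using lt s by (simp add: u_def)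
        have "u \<otimes> r = t" using lt(2) s lr(2) by (simp add: u_def R.m_assoc)
        then have ux: "u \<odot>\<^bsub>M\<^esub> x = u \<odot>\<^bsub>M\<^esub> l \<oplus>\<^bsub>M\<^esub> t \<odot>\<^bsub>M\<^esub> e"
          using lr u e Lc by (simp add: smult_r_distr smult_assoc1[symmetric])
        have eq: "y \<ominus>\<^bsub>M\<^esub> u \<odot>\<^bsub>M\<^esub> x = l' \<ominus>\<^bsub>M\<^esub> u \<odot>\<^bsub>M\<^esub> l"
          unfolding ux using lt u e lr Lc[OF lr(1)] Lc[OF lt(1)]
          by (simp add: a_minus_def M.minus_add M.a_ac M.r_neg1 M.r_neg2)
        have "l' \<ominus>\<^bsub>M\<^esub> u \<odot>\<^bsub>M\<^esub> l \<in> L"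
          using lt lr u by (intro submodule_minus[OF assms(3)] submoduleE(4)[OF assms(3)])
        moreover have ux: "u \<odot>\<^bsub>M\<^esub> x \<in> U" using u x by (intro submoduleE(4)[OF U])
        moreover have "y \<ominus>\<^bsub>M\<^esub> u \<odot>\<^bsub>M\<^esub> x \<in> V" using y ux XY by (intro submodule_minus[OF V]) auto
        ultimately have "y \<ominus>\<^bsub>M\<^esub> u \<odot>\<^bsub>M\<^esub> x \<in> U" using True eq by auto
        then have "(y \<ominus>\<^bsub>M\<^esub> u \<odot>\<^bsub>M\<^esub> x) \<oplus>\<^bsub>M\<^esub> u \<odot>\<^bsub>M\<^esub> x \<in> U" using ux by (rule submoduleE(5)[OF U])
        moreover have "y \<in> carrier M" using y submoduleE(1)[OF V] by blast
        ultimately show "y \<in> U" using u xc by (simp add: a_minus_def M.a_assoc M.l_neg)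
      qed
      with XY show False by blast
    qed
    with YnL True show ?thesis unfolding len'_def by simp
  qed
  then show "strict_length R M K (L <+>\<^bsub>M\<^esub> {r \<odot>\<^bsub>M\<^esub> e | r. r \<in> carrier R}) len'"
    unfolding strict_length_def E_def by blast
qed

text \<open>Two maximal choices of annihilators. First \<open>Q\<close> is taken with (Q : e)
  maximal among the submodules above \<open>L\<close> that have a strict length. Were e outside
  \<open>Q\<close>, a multiple b e outside \<open>Q\<close> with (Q : b e) maximal would be killed
  by \<open>\<mm>\<close> modulo \<open>Q\<close>; adjoining it keeps a strict length and puts b
  into (Q : e), which contradicts the first choice.\<close>

lemma (in module) strict_length_extend:
  assumes "noetherian_ring R" "local_ring R \<mm>" "submodule L R M" "K \<subseteq> L"
    and len: "strict_length R M K L len" and e: "e \<in> carrier M"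
    and nil: "\<And>a x. a \<in> \<mm> \<Longrightarrow> x \<in> carrier M \<Longrightarrow> \<exists>k::nat. (a [^] k) \<odot>\<^bsub>M\<^esub> x \<in> K"
  shows "\<exists>Q len'. submodule Q R M \<and> L \<subseteq> Q \<and> e \<in> Q \<and> strict_length R M K Q len'"
proof -
  interpret noetherian_ring R by fact
  have mc: "\<mm> \<subseteq> carrier R"
  proof -
    have "\<mm> \<in> {J. maximalideal J R}" using assms(2) unfolding local_ring_def by simp
    then have "maximalideal \<mm> R" by simp
    then have "ideal \<mm> R" by (rule maximalideal.axioms(1))
    then show ?thesis using ideal.Icarr by fast
  qed
  \<comment> \<open>The quantifier over a singleton matches the shape of
    \<open>submodule_colon_ideal\<close>.\<close>
  define colon where "colon Q z = {r \<in> carrier R. \<forall>x\<in>{z}. r \<odot>\<^bsub>M\<^esub> x \<in> Q}" for Q z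
  have colon_ideal: "ideal (colon Q z) R" if "submodule Q R M" "z \<in> carrier M" for Q z
    unfolding colon_def using that by (intro submodule_colon_ideal) auto
  define A where "A = {Q. submodule Q R M \<and> L \<subseteq> Q \<and> (\<exists>len'. strict_length R M K Q len')}"
  let ?F = "(\<lambda>Q. colon Q e) ` A"
  have "L \<in> A" using assms(3) len unfolding A_def by blast
  then have "\<exists>J\<in>?F. \<forall>J'\<in>?F. J \<subseteq> J' \<longrightarrow> J' = J"
    using colon_ideal[OF _ e] by (intro maximal_ideal_of_family) (auto simp: A_def)
  then obtain Q where QA: "Q \<in> A" and Qmax: "\<And>Q'. Q' \<in> A \<Longrightarrow> colon Q e \<subseteq> colon Q' e \<Longrightarrow> colon Q' e = colon Q e"
    by auto
  obtain len' where Q: "submodule Q R M" "L \<subseteq> Q" and len': "strict_length R M K Q len'"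
    using QA unfolding A_def by blast
  have "e \<in> Q"
  proof (rule ccontr)
    assume "e \<notin> Q"
    define B where "B = {b \<in> carrier R. b \<odot>\<^bsub>M\<^esub> e \<notin> Q}"
    let ?G = "(\<lambda>b. colon Q (b \<odot>\<^bsub>M\<^esub> e)) ` B"
    have "\<one> \<in> B" using \<open>e \<notin> Q\<close> e by (simp add: B_def)
    then have "\<exists>J\<in>?G. \<forall>J'\<in>?G. J \<subseteq> J' \<longrightarrow> J' = J"
      using e by (intro maximal_ideal_of_family) (auto simp: B_def intro!: colon_ideal[OF Q(1)])
    then obtain b where b: "b \<in> B"
      and bmax: "\<And>b'. b' \<in> B \<Longrightarrow> colon Q (b \<odot>\<^bsub>M\<^esub> e) \<subseteq> colon Q (b' \<odot>\<^bsub>M\<^esub> e) \<Longrightarrow>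
                  colon Q (b' \<odot>\<^bsub>M\<^esub> e) = colon Q (b \<odot>\<^bsub>M\<^esub> e)"
      by auto
    have bc: "b \<in> carrier R" "b \<odot>\<^bsub>M\<^esub> e \<notin> Q" using b by (auto simp: B_def)
    have "a \<odot>\<^bsub>M\<^esub> (b \<odot>\<^bsub>M\<^esub> e) \<in> Q" if a: "a \<in> \<mm>" for a
    proof (rule ccontr)
      assume na: "a \<odot>\<^bsub>M\<^esub> (b \<odot>\<^bsub>M\<^esub> e) \<notin> Q"
      have ac: "a \<in> carrier R" using a mc by blast
      have abe: "(a \<otimes> b) \<odot>\<^bsub>M\<^esub> e = a \<odot>\<^bsub>M\<^esub> (b \<odot>\<^bsub>M\<^esub> e)" using ac bc e by (simp add: smult_assoc1)
      have comm: "r \<odot>\<^bsub>M\<^esub> (a \<odot>\<^bsub>M\<^esub> (b \<odot>\<^bsub>M\<^esub> e)) = a \<odot>\<^bsub>M\<^esub> (r \<odot>\<^bsub>M\<^esub> (b \<odot>\<^bsub>M\<^esub> e))" if "r \<in> carrier R" for r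
        using that ac bc e by (simp add: smult_assoc1[symmetric] R.m_ac)
      have "a \<otimes> b \<in> B" using na ac bc abe by (simp add: B_def)
      moreover have "colon Q (b \<odot>\<^bsub>M\<^esub> e) \<subseteq> colon Q ((a \<otimes> b) \<odot>\<^bsub>M\<^esub> e)"
        using ac submoduleE(4)[OF Q(1) ac] comm by (auto simp: colon_def abe)
      ultimately have eq: "colon Q ((a \<otimes> b) \<odot>\<^bsub>M\<^esub> e) = colon Q (b \<odot>\<^bsub>M\<^esub> e)" by (rule bmax)
      \<comment> \<open>Since (Q : a b e) = (Q : b e), one more factor a never brings a multiple of
        b e into \<open>Q\<close>; yet some power of a sends b e into \<open>K\<close>, which lies
        in \<open>Q\<close>.\<close>
      have "(a [^] k) \<odot>\<^bsub>M\<^esub> (b \<odot>\<^bsub>M\<^esub> e) \<notin> Q" for k :: nat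
      proof (induction k)
        case 0
        show ?case using bc e by simp
      next
        case (Suc k)
        then have "a [^] k \<notin> colon Q ((a \<otimes> b) \<odot>\<^bsub>M\<^esub> e)" unfolding eq by (simp add: colon_def)
        then have "(a [^] k) \<odot>\<^bsub>M\<^esub> (a \<odot>\<^bsub>M\<^esub> (b \<odot>\<^bsub>M\<^esub> e)) \<notin> Q" using ac by (simp add: colon_def abe)
        then show ?case using ac bc e by (simp add: smult_assoc1)
      qed
      moreover have "\<exists>k::nat. (a [^] k) \<odot>\<^bsub>M\<^esub> (b \<odot>\<^bsub>M\<^esub> e) \<in> K" using bc e by (intro nil[OF a]) simp
      ultimately show False using assms(4) Q(2) by blast
    qed
    note simple = this
    let ?E = "{r \<odot>\<^bsub>M\<^esub> (b \<odot>\<^bsub>M\<^esub> e) | r. r \<in> carrier R}"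
    have be: "b \<odot>\<^bsub>M\<^esub> e \<in> carrier M" using bc e by simp
    have KQ: "K \<subseteq> Q" using assms(4) Q(2) by blast
    have ex: "\<exists>l. strict_length R M K (Q <+>\<^bsub>M\<^esub> ?E) l"
      by (rule strict_length_extend_simple[OF assms(1,2) Q(1) KQ len' be simple])
    have E: "submodule ?E R M" by (rule singleton_span_submodule[OF be])
    note up = submodule_add_upper[OF Q(1) E]
    have "Q <+>\<^bsub>M\<^esub> ?E \<in> A"
      unfolding A_def using ex submodule_add[OF Q(1) E] up(1) Q(2) by blast
    moreover have "colon Q e \<subseteq> colon (Q <+>\<^bsub>M\<^esub> ?E) e" using up(1) unfolding colon_def by auto
    ultimately have eq: "colon (Q <+>\<^bsub>M\<^esub> ?E) e = colon Q e" by (rule Qmax)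
    have "\<one> \<odot>\<^bsub>M\<^esub> (b \<odot>\<^bsub>M\<^esub> e) \<in> ?E" by blast
    then have "b \<odot>\<^bsub>M\<^esub> e \<in> Q <+>\<^bsub>M\<^esub> ?E" using up(2) be by auto
    then have "b \<in> colon (Q <+>\<^bsub>M\<^esub> ?E) e" using bc(1) by (simp add: colon_def)
    then show False unfolding eq using bc by (simp add: colon_def)
  qed
  with Q len' show ?thesis by blast
qed

text \<open>The generators are adjoined one at a time by \<open>strict_length_extend\<close>,
  starting from \<open>K\<close> itself.\<close>

lemma (in module) ex_strict_length:
  assumes "noetherian_ring R" "local_ring R \<mm>" "finitely_generated_module R M" "submodule K R M"
    and nil: "\<And>a x. a \<in> \<mm> \<Longrightarrow> x \<in> carrier M \<Longrightarrow> \<exists>k::nat. (a [^] k) \<odot>\<^bsub>M\<^esub> x \<in> K"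
  shows "\<exists>len. strict_length R M K (carrier M) len"
proof -
  obtain A where A: "finite A" "A \<subseteq> carrier M" "carrier M = submodule_span R M A"
    using assms(3) unfolding finitely_generated_module_def by blast
  have "\<exists>Q len. submodule Q R M \<and> K \<subseteq> Q \<and> A \<subseteq> Q \<and> strict_length R M K Q len"
    using A(1,2)
  proof (induction A rule: finite_induct)
    case empty
    \<comment> \<open>No strict inclusion fits between \<open>K\<close> and \<open>K\<close>, so a
      constant function is strict there.\<close>
    have "strict_length R M K K (\<lambda>_. 0)" unfolding strict_length_def by blast
    then show ?case using assms(4) by blast
  next
    case (insert e A)
    then obtain Q len where Q: "submodule Q R M" "K \<subseteq> Q" "A \<subseteq> Q" "strict_length R M K Q len"
      by auto
    have e: "e \<in> carrier M" using insert.prems by simp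
    from strict_length_extend[OF assms(1,2) Q(1,2,4) e nil] Q(2,3) show ?case
      by (metis insert_subset subset_trans)
  qed
  then obtain Q len where Q: "submodule Q R M" "A \<subseteq> Q" "strict_length R M K Q len" by blast
  have "carrier M \<subseteq> Q" using A(3) Q(1,2) unfolding submodule_span_def by blast
  then have "Q = carrier M" using submoduleE(1)[OF Q(1)] by blast
  with Q(3) show ?thesis by blast
qed


section \<open>Commuting endomorphisms of a module of finite length\<close>

text \<open>Submodules containing \<open>K\<close> stand for submodules of M / K, so that no
  quotient module is formed; \<open>len\<close> expresses that M / K has finite length.\<close>

locale commuting_endos = module R M
  for R :: "('a, 'c) ring_scheme" (structure) and M :: "('a, 'b, 'd) module_scheme" (structure) +
  fixes K :: "'b set" and S :: "('b \<Rightarrow> 'b) set" and len :: "'b set \<Rightarrow> nat"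
  assumes len: "strict_length R M K (carrier M) len"
    and endo: "s \<in> S \<Longrightarrow> module_endo R M s"
    and comm: "s \<in> S \<Longrightarrow> t \<in> S \<Longrightarrow> x \<in> carrier M \<Longrightarrow> s (t x) = t (s x)"

text \<open>These are the submodules of M / K over the commutative algebra generated by
  \<open>S\<close>, once \<open>S\<close> preserves \<open>K\<close>.\<close>

definition (in commuting_endos) stable :: "'b set \<Rightarrow> bool" where
  "stable N \<longleftrightarrow> submodule N R M \<and> K \<subseteq> N \<and> (\<forall>s\<in>S. \<forall>x\<in>N. s x \<in> N)"

lemma (in commuting_endos) stableD:
  assumes "stable N"
  shows "submodule N R M" "K \<subseteq> N" "s \<in> S \<Longrightarrow> x \<in> N \<Longrightarrow> s x \<in> N" "x \<in> N \<Longrightarrow> x \<in> carrier M"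
  using assms submoduleE(1)[of N] unfolding stable_def by blast+

lemma (in commuting_endos) len_strict:
  assumes "stable N" "stable N'" "N \<subset> N'"
  shows "len N < len N'"
  using len stableD(1,2)[OF assms(1)] stableD(1)[OF assms(2)] assms(3) submoduleE(1)[OF stableD(1)[OF assms(2)]]
  unfolding strict_length_def by blast

lemma (in commuting_endos) len_le_carrier:
  assumes "stable N"
  shows "len N \<le> len (carrier M)"
proof (cases "N = carrier M")
  case False
  have "N \<subseteq> carrier M" using submoduleE(1)[OF stableD(1)[OF assms]] .
  with False have "N \<subset> carrier M" by blast
  then show ?thesis
    using len stableD(1,2)[OF assms] carrier_is_submodule unfolding strict_length_def by fastforce
qed simp

text \<open>Here and in \<open>stable_preimage\<close> commutativity enters:
  \<open>t (s w) = s (t w)\<close> keeps the image under s invariant under the other members of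
  \<open>S\<close>.\<close>

lemma (in commuting_endos) stable_image_add:
  assumes "stable W" "stable L" "s \<in> S"
  shows "stable (s ` W <+>\<^bsub>M\<^esub> L)"
proof -
  note sub = endo_image_submodule[OF endo[OF assms(3)] stableD(1)[OF assms(1)]]
  have "t x \<in> s ` W <+>\<^bsub>M\<^esub> L" if t: "t \<in> S" and x: "x \<in> s ` W <+>\<^bsub>M\<^esub> L" for t x
  proof -
    obtain w l where wl: "w \<in> W" "l \<in> L" "x = s w \<oplus>\<^bsub>M\<^esub> l" using x unfolding set_add_def' by blast
    note c = stableD(4)[OF assms(1) wl(1)] stableD(4)[OF assms(2) wl(2)]
    have "t x = s (t w) \<oplus>\<^bsub>M\<^esub> t l"
      using wl(3) c module_endoD(1)[OF endo[OF assms(3)]] module_endoD(2)[OF endo[OF t]]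
        comm[OF t assms(3)] by simp
    moreover have "s (t w) \<in> s ` W" using stableD(3)[OF assms(1) t wl(1)] by blast
    moreover have "t l \<in> L" using stableD(3)[OF assms(2) t wl(2)] .
    ultimately show ?thesis by (simp add: set_addI)
  qed
  moreover have "K \<subseteq> s ` W <+>\<^bsub>M\<^esub> L"
    using submodule_add_upper(2)[OF sub stableD(1)[OF assms(2)]] stableD(2)[OF assms(2)] by blast
  ultimately show ?thesis
    unfolding stable_def using submodule_add[OF sub stableD(1)[OF assms(2)]] by blast
qed

lemma (in commuting_endos) stable_preimage:
  assumes "stable W" "stable L" "s \<in> S"
  shows "stable {w \<in> W. s w \<in> L}"
proof -
  have "t x \<in> {w \<in> W. s w \<in> L}" if t: "t \<in> S" and x: "x \<in> {w \<in> W. s w \<in> L}" for t x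
    using x comm[OF assms(3) t] stableD(3,4)[OF assms(1)] stableD(3)[OF assms(2)] t by auto
  moreover have "K \<subseteq> {w \<in> W. s w \<in> L}"
    using stableD(2)[OF assms(1)] stableD(2,3)[OF assms(2)] assms(3) by blast
  ultimately show ?thesis
    unfolding stable_def
    using endo_preimage_submodule[OF endo[OF assms(3)] stableD(1)[OF assms(1)] stableD(1)[OF assms(2)]]
    by blast
qed

section \<open>Chain conditions for stable submodules\<close>

lemma (in commuting_endos) descending_chain:
  assumes "\<And>k. stable (N k)" "\<And>k. N (Suc k) \<subseteq> N k"
  shows "\<exists>k. N (Suc k) = N k"
proof (rule ccontr)
  assume neg: "\<not> ?thesis"
  have "len (N k) + k \<le> len (N 0)" for k
  proof (induction k)
    case (Suc k)
    have "N (Suc k) \<subset> N k" using neg assms(2) by blast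
    then have "len (N (Suc k)) < len (N k)" by (rule len_strict[OF assms(1) assms(1)])
    with Suc.IH show ?case by simp
  qed simp
  from this[of "Suc (len (N 0))"] show False by simp
qed

lemma (in commuting_endos) ascending_chain:
  assumes "\<And>k. stable (N k)" "\<And>k. N k \<subseteq> N (Suc k)"
  shows "\<exists>k. N (Suc k) = N k"
proof (rule ccontr)
  assume neg: "\<not> ?thesis"
  have "k \<le> len (N k)" for k
  proof (induction k)
    case (Suc k)
    have "N k \<subset> N (Suc k)" using neg assms(2) by blast
    then have "len (N k) < len (N (Suc k))" by (rule len_strict[OF assms(1) assms(1)])
    with Suc.IH show ?case by simp
  qed simp
  from this[of "Suc (len (carrier M))"] len_le_carrier[OF assms(1)[of "Suc (len (carrier M))"]]
  show False by simp
qed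

lemma (in commuting_endos) minimal_stable:
  assumes "stable N" "P N"
  shows "\<exists>N. stable N \<and> P N \<and> (\<forall>N'. stable N' \<longrightarrow> P N' \<longrightarrow> N' \<subseteq> N \<longrightarrow> N' = N)"
proof -
  obtain N where N: "stable N \<and> P N" "\<And>N'. stable N' \<and> P N' \<Longrightarrow> len N \<le> len N'"
    using ex_has_least_nat[of "\<lambda>N. stable N \<and> P N" N len] assms by blast
  have "N' = N" if "stable N'" "P N'" "N' \<subseteq> N" for N'
    using N(2)[of N'] len_strict[of N' N] N(1) that by fastforce
  with N(1) show ?thesis by blast
qed

lemma (in commuting_endos) maximal_stable:
  assumes "stable N" "P N"
  shows "\<exists>N. stable N \<and> P N \<and> (\<forall>N'. stable N' \<longrightarrow> P N' \<longrightarrow> N \<subseteq> N' \<longrightarrow> N' = N)"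
proof -
  have "\<exists>N. (stable N \<and> P N) \<and> (\<forall>N'. stable N' \<and> P N' \<longrightarrow> len N' \<le> len N)"
    by (rule ex_has_greatest_nat[of _ N _ "Suc (len (carrier M))"])
      (use assms len_le_carrier in \<open>auto simp: less_Suc_eq_le\<close>)
  then obtain N where N: "stable N \<and> P N" "\<And>N'. stable N' \<and> P N' \<Longrightarrow> len N' \<le> len N"
    by blast
  have "N' = N" if "stable N'" "P N'" "N \<subseteq> N'" for N'
    using N(2)[of N'] len_strict[of N N'] N(1) that by fastforce
  with N(1) show ?thesis by blast
qed

section \<open>Fitting's argument for a single endomorphism\<close>

text \<open>Since s preserves \<open>L\<close>, the iterate \<open>(f ^^ k) W\<close> is s^k W + L,
  the image of the k-th power of the map induced by s on W / L.\<close>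

lemma (in commuting_endos) image_iterates:
  fixes k :: nat
  assumes "stable W" "stable L" "L \<subseteq> W" "s \<in> S"
  defines "f \<equiv> (\<lambda>N. s ` N <+>\<^bsub>M\<^esub> L)"
  shows "stable ((f ^^ k) W)" "L \<subseteq> (f ^^ k) W" "(f ^^ Suc k) W \<subseteq> (f ^^ k) W"
proof -
  show st: "stable ((f ^^ k) W)" for k
    by (induction k) (simp_all add: assms(1,2,4) f_def stable_image_add)
  show "L \<subseteq> (f ^^ k) W"
  proof (cases k)
    case (Suc j)
    show ?thesis
      using submodule_add_upper(2)[OF endo_image_submodule[OF endo[OF assms(4)] stableD(1)[OF st[of j]]]
          stableD(1)[OF assms(2)]]
      by (simp add: Suc f_def)
  qed (simp add: assms(3))
  show "(f ^^ Suc k) W \<subseteq> (f ^^ k) W"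
  proof (induction k)
    case 0
    have "s ` W \<subseteq> W" using stableD(3)[OF assms(1,4)] by blast
    then show ?case
      using submodule_add_least[OF stableD(1)[OF assms(1)] _ assms(3)] by (simp add: f_def)
  next
    case (Suc k)
    have mono: "f A \<subseteq> f B" if "A \<subseteq> B" for A B
      using that unfolding f_def set_add_def' by blast
    from mono[OF Suc.IH] show ?case by simp
  qed
qed

text \<open>Dually, \<open>(g ^^ k) L\<close> is the kernel of the k-th power of the map induced by
  s on W / L.\<close>

lemma (in commuting_endos) preimage_iterates:
  fixes k :: nat
  assumes "stable W" "stable L" "L \<subseteq> W" "s \<in> S"
  defines "g \<equiv> (\<lambda>N. {w \<in> W. s w \<in> N})"
  shows "stable ((g ^^ k) L)" "(g ^^ k) L \<subseteq> W" "(g ^^ k) L \<subseteq> (g ^^ Suc k) L" "L \<subseteq> (g ^^ k) L"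
proof -
  show "stable ((g ^^ k) L)"
    by (induction k) (simp_all add: assms(1,2,4) g_def stable_preimage)
  show "(g ^^ k) L \<subseteq> W" by (cases k) (auto simp: g_def assms(3))
  show inc: "(g ^^ k) L \<subseteq> (g ^^ Suc k) L" for k
  proof (induction k)
    case 0
    show ?case using stableD(3)[OF assms(2,4)] assms(3) by (auto simp: g_def)
  next
    case (Suc k)
    have mono: "g A \<subseteq> g B" if "A \<subseteq> B" for A B using that unfolding g_def by blast
    from mono[OF Suc.IH] show ?case by simp
  qed
  show "L \<subseteq> (g ^^ k) L"
  proof (induction k)
    case (Suc k)
    with inc[of k] show ?case by blast
  qed simp
qed

text \<open>The kernels of the powers of s on W / L become stationary. Surjectivity lowers the index
  at which this happens step by step to 0, where it says that s itself has zero kernel on W /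
  L.\<close>

lemma (in commuting_endos) surjective_imp_injective:
  assumes st: "stable W" "stable L" "L \<subseteq> W" "s \<in> S"
    and surj: "W \<subseteq> s ` W <+>\<^bsub>M\<^esub> L" and w: "w \<in> W" "s w \<in> L"
  shows "w \<in> L"
proof -
  define g where "g = (\<lambda>N. {w \<in> W. s w \<in> N})"
  note it = preimage_iterates[OF st, folded g_def]
  obtain k where k: "(g ^^ Suc k) L = (g ^^ k) L"
    using ascending_chain[of "\<lambda>k. (g ^^ k) L"] it(1,3) by blast
  \<comment> \<open>Write x as s v + l. Then v lies in the iterate with index j + 2, hence in the
    one with index j + 1, and this puts s v and with it x into the iterate with index j.\<close>
  have step: "(g ^^ Suc j) L \<subseteq> (g ^^ j) L" if eq: "(g ^^ Suc (Suc j)) L = (g ^^ Suc j) L" for j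
  proof
    fix x assume x: "x \<in> (g ^^ Suc j) L"
    then have "x \<in> s ` W <+>\<^bsub>M\<^esub> L" using it(2)[of "Suc j"] surj by blast
    then obtain v l where vl: "v \<in> W" "l \<in> L" "x = s v \<oplus>\<^bsub>M\<^esub> l" unfolding set_add_def' by blast
    note c = stableD(4)[OF st(2) vl(2)] stableD(4)[OF st(1) stableD(3)[OF st(1) st(4) vl(1)]]
    have "s v = x \<ominus>\<^bsub>M\<^esub> l"
      using c unfolding vl(3) by (simp add: a_minus_def M.a_assoc M.r_neg)
    moreover have "l \<in> (g ^^ Suc j) L" using it(4) vl(2) by blast
    ultimately have "s v \<in> (g ^^ Suc j) L" using submodule_minus[OF stableD(1)[OF it(1)]] x by metis
    then have "v \<in> (g ^^ Suc (Suc j)) L" using vl(1) by (simp add: g_def)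
    then have "v \<in> (g ^^ Suc j) L" using eq by blast
    then have "s v \<in> (g ^^ j) L" by (simp add: g_def)
    moreover have "l \<in> (g ^^ j) L" using it(4) vl(2) by blast
    ultimately show "x \<in> (g ^^ j) L" unfolding vl(3) by (rule submoduleE(5)[OF stableD(1)[OF it(1)]])
  qed
  have "(g ^^ Suc j) L = (g ^^ j) L \<Longrightarrow> g L \<subseteq> L" for j
  proof (induction j)
    case (Suc j)
    have "(g ^^ Suc j) L = (g ^^ j) L" using step[OF Suc.prems] it(3)[of j] by blast
    then show ?case by (rule Suc.IH)
  qed simp
  then have "g L \<subseteq> L" using k by blast
  then show ?thesis using w unfolding g_def by blast
qed

text \<open>The dual argument, with the images of the powers of s in place of the kernels.\<close>

lemma (in commuting_endos) injective_imp_surjective: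
  assumes st: "stable W" "stable L" "L \<subseteq> W" "s \<in> S"
    and inj: "\<And>w. w \<in> W \<Longrightarrow> s w \<in> L \<Longrightarrow> w \<in> L"
  shows "W \<subseteq> s ` W <+>\<^bsub>M\<^esub> L"
proof -
  define f where "f = (\<lambda>N. s ` N <+>\<^bsub>M\<^esub> L)"
  note it = image_iterates[OF st, folded f_def]
  obtain k where k: "(f ^^ Suc k) W = (f ^^ k) W"
    using descending_chain[of "\<lambda>k. (f ^^ k) W"] it(1,3) by blast
  have leW: "(f ^^ j) W \<subseteq> W" for j
  proof (induction j)
    case (Suc j)
    with it(3)[of j] show ?case by blast
  qed simp
  \<comment> \<open>Equality one stage later gives \<open>s w = s v\<close> modulo \<open>L\<close>
    for some v in the smaller image; by injectivity w and v then agree modulo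
    \<open>L\<close>.\<close>
  have step: "(f ^^ j) W \<subseteq> (f ^^ Suc j) W" if eq: "(f ^^ Suc (Suc j)) W = (f ^^ Suc j) W" for j
  proof
    fix w assume w: "w \<in> (f ^^ j) W"
    have "s ` (f ^^ j) W \<subseteq> (f ^^ Suc j) W"
      using submodule_add_upper(1)[OF endo_image_submodule[OF endo[OF st(4)] stableD(1)[OF it(1)[of j]]]
          stableD(1)[OF st(2)]] by (simp add: f_def)
    then have "s w \<in> (f ^^ Suc j) W" using w by blast
    then have "s w \<in> f ((f ^^ Suc j) W)" using eq by simp
    then obtain v l where vl: "v \<in> (f ^^ Suc j) W" "l \<in> L" "s w = s v \<oplus>\<^bsub>M\<^esub> l"
      unfolding f_def set_add_def' by blast
    note c = stableD(4)[OF it(1) w] stableD(4)[OF it(1) vl(1)] stableD(4)[OF st(2) vl(2)]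
    have sv: "s v \<in> carrier M" using c module_endoD(1)[OF endo[OF st(4)]] by simp
    have "s (w \<ominus>\<^bsub>M\<^esub> v) = l"
      using c sv by (simp add: module_endoD(6)[OF endo[OF st(4)]] vl(3))
        (simp add: a_minus_def M.a_ac M.r_neg M.r_neg2 M.r_neg1)
    moreover have "w \<ominus>\<^bsub>M\<^esub> v \<in> W"
      using w vl(1) leW by (intro submodule_minus[OF stableD(1)[OF st(1)]]) blast+
    ultimately have "w \<ominus>\<^bsub>M\<^esub> v \<in> L" using inj vl(2) by simp
    then have "w \<ominus>\<^bsub>M\<^esub> v \<in> (f ^^ Suc j) W" using it(2)[of "Suc j"] by blast
    then have "(w \<ominus>\<^bsub>M\<^esub> v) \<oplus>\<^bsub>M\<^esub> v \<in> (f ^^ Suc j) W"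
      using vl(1) by (rule submoduleE(5)[OF stableD(1)[OF it(1)]])
    moreover have "(w \<ominus>\<^bsub>M\<^esub> v) \<oplus>\<^bsub>M\<^esub> v = w" using c by (simp add: a_minus_def M.a_assoc M.l_neg)
    ultimately show "w \<in> (f ^^ Suc j) W" by simp
  qed
  have "(f ^^ Suc j) W = (f ^^ j) W \<Longrightarrow> W \<subseteq> f W" for j
  proof (induction j)
    case (Suc j)
    have "(f ^^ Suc j) W = (f ^^ j) W" using step[OF Suc.prems] it(3)[of j] by blast
    then show ?case by (rule Suc.IH)
  qed simp
  then show ?thesis using k unfolding f_def by blast
qed

section \<open>Families of commuting endomorphisms\<close>

text \<open>The assumption that quantifies over \<open>N\<close> says that the images of
  \<open>W\<close> generate W / L, without forming a sum over \<open>S\<close>. Some s is nonzero,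
  hence surjective, on a quotient W / N with \<open>N\<close> maximal proper stable, so s is not
  nilpotent on W / L. The limit \<open>L'\<close> of its image chain is strictly above
  \<open>L\<close>. Induction for W / L' puts w into \<open>L'\<close>, and on L' / L the single map
  s is surjective, hence injective.\<close>

lemma (in commuting_endos) jointly_surjective_imp_jointly_injective:
  assumes "stable W" "stable L" "L \<subseteq> W"
    and "\<And>N. submodule N R M \<Longrightarrow> L \<subseteq> N \<Longrightarrow> (\<And>s. s \<in> S \<Longrightarrow> s ` W \<subseteq> N) \<Longrightarrow> W \<subseteq> N"
    and "w \<in> W" "\<And>s. s \<in> S \<Longrightarrow> s w \<in> L"
  shows "w \<in> L"
  using assms(2-6)
proof (induction "len W - len L" arbitrary: L rule: less_induct)
  case less
  note L = less.prems(1) and LW = less.prems(2) and surj = less.prems(3)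
  show ?case
  proof (cases "L = W")
    case True
    with less.prems(4) show ?thesis by simp
  next
    case False
    have "\<exists>N. stable N \<and> (L \<subseteq> N \<and> N \<subset> W) \<and>
        (\<forall>N'. stable N' \<longrightarrow> (L \<subseteq> N' \<and> N' \<subset> W) \<longrightarrow> N \<subseteq> N' \<longrightarrow> N' = N)"
      by (rule maximal_stable[of L "\<lambda>N. L \<subseteq> N \<and> N \<subset> W"]) (use False LW L in auto)
    then obtain N where N: "stable N" "L \<subseteq> N" "N \<subset> W"
      and max: "\<forall>N'. stable N' \<longrightarrow> L \<subseteq> N' \<and> N' \<subset> W \<longrightarrow> N \<subseteq> N' \<longrightarrow> N' = N"
      by (elim exE conjE) (rule that)
    note max = max[rule_format, OF _ conjI]
    have "\<not> (\<forall>s\<in>S. s ` W \<subseteq> N)"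
      using surj[OF stableD(1)[OF N(1)] N(2)] N(3) by blast
    then obtain s where s: "s \<in> S" "\<not> s ` W \<subseteq> N" by blast
    have sW: "submodule (s ` W) R M" by (rule endo_image_submodule[OF endo[OF s(1)] stableD(1)[OF assms(1)]])
    note up = submodule_add_upper[OF sW stableD(1)[OF N(1)]]
    have "s ` W \<subseteq> W" using stableD(3)[OF assms(1) s(1)] by blast
    then have "s ` W <+>\<^bsub>M\<^esub> N \<subseteq> W"
      using N(3) by (intro submodule_add_least[OF stableD(1)[OF assms(1)]]) auto
    moreover have "s ` W <+>\<^bsub>M\<^esub> N \<noteq> N" using up(1) s(2) by auto
    moreover have "L \<subseteq> s ` W <+>\<^bsub>M\<^esub> N" using up(2) N(2) by blast
    ultimately have W_eq: "W \<subseteq> s ` W <+>\<^bsub>M\<^esub> N"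
      using max[OF stable_image_add[OF assms(1) N(1) s(1)] _ _ up(2)] by blast
    define f where "f = (\<lambda>N. s ` N <+>\<^bsub>M\<^esub> L)"
    note it = image_iterates[OF assms(1) L LW s(1), folded f_def]
    obtain k where k: "(f ^^ Suc k) W = (f ^^ k) W"
      using descending_chain[of "\<lambda>k. (f ^^ k) W"] it(1,3) by blast
    have leW: "(f ^^ j) W \<subseteq> W" for j
    proof (induction j)
      case (Suc j)
      with it(3)[of j] show ?case by blast
    qed simp
    \<comment> \<open>As s is surjective on W / N, so are its powers; thus no iterate shrinks into
      \<open>N\<close>, which later separates \<open>L'\<close> from \<open>L\<close>.\<close>
    have cover: "W \<subseteq> (f ^^ j) W <+>\<^bsub>M\<^esub> N" for j
    proof (induction j)
      case 0
      show ?case using submodule_add_upper(1)[OF stableD(1)[OF assms(1)] stableD(1)[OF N(1)]] by simp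
    next
      case (Suc j)
      note T = submodule_add[OF stableD(1)[OF it(1)[of "Suc j"]] stableD(1)[OF N(1)]]
      note upT = submodule_add_upper[OF stableD(1)[OF it(1)[of "Suc j"]] stableD(1)[OF N(1)]]
      have "s ` W \<subseteq> (f ^^ Suc j) W <+>\<^bsub>M\<^esub> N"
      proof
        fix y assume "y \<in> s ` W"
        then obtain v where v: "v \<in> W" "y = s v" by blast
        then have "v \<in> (f ^^ j) W <+>\<^bsub>M\<^esub> N" using Suc.IH by blast
        then obtain p q where pq: "p \<in> (f ^^ j) W" "q \<in> N" "v = p \<oplus>\<^bsub>M\<^esub> q"
          unfolding set_add_def' by blast
        have y: "y = s p \<oplus>\<^bsub>M\<^esub> s q"
          using v(2) pq(3) module_endoD(2)[OF endo[OF s(1)] stableD(4)[OF it(1) pq(1)] stableD(4)[OF N(1) pq(2)]]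
          by simp
        have "s ` (f ^^ j) W \<subseteq> (f ^^ Suc j) W"
          using submodule_add_upper(1)[OF endo_image_submodule[OF endo[OF s(1)] stableD(1)[OF it(1)[of j]]]
              stableD(1)[OF L]] by (simp add: f_def)
        then have "s p \<in> (f ^^ Suc j) W" using pq(1) by blast
        moreover have "s q \<in> N" by (rule stableD(3)[OF N(1) s(1) pq(2)])
        ultimately show "y \<in> (f ^^ Suc j) W <+>\<^bsub>M\<^esub> N" unfolding y by (rule set_addI)
      qed
      then have "s ` W <+>\<^bsub>M\<^esub> N \<subseteq> (f ^^ Suc j) W <+>\<^bsub>M\<^esub> N"
        using upT(2) by (rule submodule_add_least[OF T])
      with W_eq show ?case by blast
    qed
    define L' where "L' = (f ^^ k) W"
    have L': "stable L'" "L \<subseteq> L'" "L' \<subseteq> W" unfolding L'_def by (rule it(1) it(2) leW)+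
    have "f L' = L'" using k by (simp add: L'_def)
    then have surj': "L' \<subseteq> s ` L' <+>\<^bsub>M\<^esub> L" by (simp add: f_def)
    have "L' \<noteq> L"
    proof
      assume "L' = L"
      then have "(f ^^ k) W <+>\<^bsub>M\<^esub> N \<subseteq> N"
        using N(2) unfolding L'_def by (intro submodule_add_least[OF stableD(1)[OF N(1)]]) auto
      then show False using cover[of k] N(3) by blast
    qed
    then have "len L < len L'" using L' L by (intro len_strict) auto
    moreover have "len L < len W" using False LW by (intro len_strict[OF L assms(1)]) blast
    ultimately have "len W - len L' < len W - len L" by linarith
    then have "w \<in> L'"
    proof (rule less.hyps[OF _ L'(1,3)])
      show "W \<subseteq> N" if "submodule N R M" "L' \<subseteq> N" "\<And>s. s \<in> S \<Longrightarrow> s ` W \<subseteq> N" for N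
        by (rule surj[OF that(1) subset_trans[OF L'(2) that(2)] that(3)])
      show "s w \<in> L'" if "s \<in> S" for s using less.prems(5)[OF that] L'(2) by blast
    qed (rule less.prems(4))
    then show ?thesis
      using surjective_imp_injective[OF L'(1) L L'(2) s(1) surj'] less.prems(5)[OF s(1)] by blast
  qed
qed

text \<open>The dual argument. Some s is nonzero, hence injective, on U / L with \<open>U\<close>
  minimal stable above \<open>L\<close>, so the limit \<open>W'\<close> of its kernel chain meets
  \<open>U\<close> only in \<open>L\<close> and is strictly below \<open>W\<close>. Induction puts
  \<open>W'\<close> inside \<open>N\<close>. On W / W' the map s is injective, hence surjective, so
  W = s W + W' lies in \<open>N\<close>.\<close>

lemma (in commuting_endos) jointly_injective_imp_jointly_surjective:
  assumes "stable W" "stable L" "L \<subseteq> W"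
    and "\<And>w. w \<in> W \<Longrightarrow> (\<And>s. s \<in> S \<Longrightarrow> s w \<in> L) \<Longrightarrow> w \<in> L"
    and "submodule N R M" "L \<subseteq> N" "\<And>s. s \<in> S \<Longrightarrow> s ` W \<subseteq> N"
  shows "W \<subseteq> N"
  using assms(1,3,4,7)
proof (induction "len W" arbitrary: W rule: less_induct)
  case less
  note W = less.prems(1) and LW = less.prems(2) and inj = less.prems(3)
  show ?case
  proof (cases "W = L")
    case True
    with assms(6) show ?thesis by simp
  next
    case False
    have "\<exists>U. stable U \<and> (L \<subset> U \<and> U \<subseteq> W) \<and>
        (\<forall>N'. stable N' \<longrightarrow> (L \<subset> N' \<and> N' \<subseteq> W) \<longrightarrow> N' \<subseteq> U \<longrightarrow> N' = U)"
      by (rule minimal_stable[of W "\<lambda>N. L \<subset> N \<and> N \<subseteq> W"]) (use False LW W in auto)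
    then obtain U where U: "stable U" "L \<subset> U" "U \<subseteq> W"
      and min: "\<forall>N'. stable N' \<longrightarrow> L \<subset> N' \<and> N' \<subseteq> W \<longrightarrow> N' \<subseteq> U \<longrightarrow> N' = U"
      by (elim exE conjE) (rule that)
    note min = min[rule_format, OF _ conjI]
    obtain u where u: "u \<in> U" "u \<notin> L" using U(2) by blast
    then have "\<not> (\<forall>s\<in>S. s u \<in> L)" using inj[of u] U(3) by blast
    then obtain s where s: "s \<in> S" "\<not> s ` U \<subseteq> L" using u(1) by blast
    have "L \<subseteq> {x \<in> U. s x \<in> L}" using U(2) stableD(3)[OF assms(2) s(1)] by blast
    moreover have "{x \<in> U. s x \<in> L} \<noteq> U" using s(2) by blast
    ultimately have Us: "{x \<in> U. s x \<in> L} \<subseteq> L"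
      using min[OF stable_preimage[OF U(1) assms(2) s(1)]] U(3) by blast
    define g where "g = (\<lambda>N. {w \<in> W. s w \<in> N})"
    note it = preimage_iterates[OF W assms(2) LW s(1), folded g_def]
    obtain k where k: "(g ^^ Suc k) L = (g ^^ k) L"
      using ascending_chain[of "\<lambda>k. (g ^^ k) L"] it(1,3) by blast
    \<comment> \<open>The iterates are the kernels of the powers of s, and these powers are
      injective on U / L.\<close>
    have meet: "(g ^^ j) L \<inter> U \<subseteq> L" for j
    proof (induction j)
      case (Suc j)
      show ?case
      proof
        fix x assume x: "x \<in> (g ^^ Suc j) L \<inter> U"
        then have "s x \<in> (g ^^ j) L" by (simp add: g_def)
        moreover have "s x \<in> U" using stableD(3)[OF U(1) s(1)] x by blast
        ultimately have "s x \<in> L" using Suc.IH by blast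
        then show "x \<in> L" using Us x by blast
      qed
    qed simp
    define W' where "W' = (g ^^ k) L"
    have W': "stable W'" "L \<subseteq> W'" "W' \<subseteq> W" unfolding W'_def by (rule it(1) it(4) it(2))+
    have "W' \<noteq> W" using meet[of k] U(2,3) unfolding W'_def by blast
    then have "len W' < len W" using W' W by (intro len_strict) auto
    then have W'N: "W' \<subseteq> N"
    proof (rule less.hyps[OF _ W'(1,2)])
      show "w \<in> L" if "w \<in> W'" "\<And>s. s \<in> S \<Longrightarrow> s w \<in> L" for w
      proof (rule inj)
        show "w \<in> W" using that(1) W'(3) by blast
      qed (rule that(2))
      show "s ` W' \<subseteq> N" if "s \<in> S" for s using less.prems(4)[OF that] W'(3) by blast
    qed
    have "g W' = W'" using k by (simp add: W'_def)
    then have "w \<in> W'" if "w \<in> W" "s w \<in> W'" for w using that unfolding g_def by blast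
    then have "W \<subseteq> s ` W <+>\<^bsub>M\<^esub> W'" by (rule injective_imp_surjective[OF W W'(1,3) s(1)])
    moreover have "s ` W <+>\<^bsub>M\<^esub> W' \<subseteq> N"
      using less.prems(4)[OF s(1)] W'N by (rule submodule_add_least[OF assms(5)])
    ultimately show ?thesis by blast
  qed
qed


section \<open>The modules \<open>I M\<close> and \<open>Hom(I, M)\<close>\<close>

text \<open>The source of all the maps written with an inverse: the endomorphisms h_a of both
  directions, and the final maps theta and phi.\<close>

lemma (in module) endo_inj_factor:
  assumes f: "module_endo R M f" "inj_on f (carrier M)" and g: "module_endo R M g"
    and sub: "g ` carrier M \<subseteq> f ` carrier M"
  shows "\<exists>h. module_endo R M h \<and> (\<forall>x\<in>carrier M. f (h x) = g x)"
proof (intro exI conjI)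
  define h where "h x = inv_into (carrier M) f (g x)" for x
  have hc: "h x \<in> carrier M" and fh: "f (h x) = g x" if x: "x \<in> carrier M" for x
  proof -
    have "g x \<in> f ` carrier M" using sub x by blast
    then show "h x \<in> carrier M" "f (h x) = g x"
      unfolding h_def by (rule inv_into_into, rule f_inv_into_f)
  qed
  show "module_endo R M h"
    unfolding module_endo_def
  proof (intro conjI ballI)
    show "h \<in> carrier M \<rightarrow> carrier M" using hc by simp
  next
    fix x y assume xy: "x \<in> carrier M" "y \<in> carrier M"
    then have "f (h (x \<oplus>\<^bsub>M\<^esub> y)) = f (h x \<oplus>\<^bsub>M\<^esub> h y)"
      by (simp add: fh hc module_endoD(2)[OF f(1)] module_endoD(2)[OF g])
    then show "h (x \<oplus>\<^bsub>M\<^esub> y) = h x \<oplus>\<^bsub>M\<^esub> h y"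
      by (rule inj_onD[OF f(2)]) (use xy hc in auto)
  next
    fix a x assume ax: "a \<in> carrier R" "x \<in> carrier M"
    then have "f (h (a \<odot>\<^bsub>M\<^esub> x)) = f (a \<odot>\<^bsub>M\<^esub> h x)"
      by (simp add: fh hc module_endoD(3)[OF f(1)] module_endoD(3)[OF g])
    then show "h (a \<odot>\<^bsub>M\<^esub> x) = a \<odot>\<^bsub>M\<^esub> h x"
      by (rule inj_onD[OF f(2)]) (use ax hc in auto)
  qed
  show "\<forall>x\<in>carrier M. f (h x) = g x" using fh by blast
qed

lemma (in module) endo_smult_comp:
  assumes "module_endo R M f" "a \<in> carrier R"
  shows "module_endo R M (\<lambda>x. a \<odot>\<^bsub>M\<^esub> f x)"
  using assms module_endoD[OF assms(1)]
  by (simp add: module_endo_def smult_r_distr smult_assoc1[symmetric] R.m_comm)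

lemma (in module) ideal_smult_submodule:
  assumes "ideal I R"
  shows "submodule (ideal_smult R I M) R M"
  unfolding ideal_smult_def
  by (rule submodule_span_submodule) (use ideal.Icarr[OF assms] in auto)

lemma (in module) ideal_smultI:
  "a \<in> I \<Longrightarrow> x \<in> carrier M \<Longrightarrow> a \<odot>\<^bsub>M\<^esub> x \<in> ideal_smult R I M"
  unfolding ideal_smult_def submodule_span_def by blast

lemma (in module) ideal_smult_least:
  assumes "submodule N R M" "\<And>a x. a \<in> I \<Longrightarrow> x \<in> carrier M \<Longrightarrow> a \<odot>\<^bsub>M\<^esub> x \<in> N"
  shows "ideal_smult R I M \<subseteq> N"
  unfolding ideal_smult_def submodule_span_def using assms by blast

text \<open>Regularity of c is stated as injectivity, the form in which
  \<open>endo_inj_factor\<close> divides by c.\<close>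

locale regular_in_ideal = module R M
  for R :: "('a, 'c) ring_scheme" (structure) and M :: "('a, 'b, 'd) module_scheme" (structure) +
  fixes I :: "'a set" and c :: 'a
  assumes I: "ideal I R" and cI: "c \<in> I"
    and regular: "inj_on ((\<odot>\<^bsub>M\<^esub>) c) (carrier M)"

definition (in regular_in_ideal) cM :: "'b set" where
  "cM = (\<odot>\<^bsub>M\<^esub>) c ` carrier M"

text \<open>\<open>c\<close> times the fractional colon \<open>(M : I)\<close>; evaluation at \<open>c\<close> identifies it with \<open>Hom(I, M)\<close>.\<close>

definition (in regular_in_ideal) colon :: "'b set" where
  "colon = {y \<in> carrier M. \<forall>a\<in>I. a \<odot>\<^bsub>M\<^esub> y \<in> cM}"

lemma (in regular_in_ideal) I_carrier: "a \<in> I \<Longrightarrow> a \<in> carrier R"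
  using ideal.Icarr[OF I] .

lemma (in regular_in_ideal) c_carrier: "c \<in> carrier R"
  using I_carrier cI .

lemma (in regular_in_ideal) smult_commute:
  "a \<in> carrier R \<Longrightarrow> b \<in> carrier R \<Longrightarrow> x \<in> carrier M \<Longrightarrow> a \<odot>\<^bsub>M\<^esub> (b \<odot>\<^bsub>M\<^esub> x) = b \<odot>\<^bsub>M\<^esub> (a \<odot>\<^bsub>M\<^esub> x)"
  by (simp add: smult_assoc1[symmetric] R.m_comm)

lemma (in regular_in_ideal) cM_submodule: "submodule cM R M"
  unfolding cM_def by (rule smult_image_submodule[OF c_carrier])

lemma (in regular_in_ideal) endo_cM:
  assumes "module_endo R M f" "x \<in> cM"
  shows "f x \<in> cM"
proof -
  obtain y where y: "y \<in> carrier M" "x = c \<odot>\<^bsub>M\<^esub> y" using assms(2) unfolding cM_def by blast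
  then have "f x = c \<odot>\<^bsub>M\<^esub> f y" using module_endoD(3)[OF assms(1) c_carrier] by simp
  then show ?thesis unfolding cM_def using module_endoD(1)[OF assms(1) y(1)] by blast
qed

lemma (in regular_in_ideal) cM_subset: "cM \<subseteq> ideal_smult R I M"
  unfolding cM_def using ideal_smultI[OF cI] by blast

lemma (in regular_in_ideal) cM_colon: "cM \<subseteq> colon"
  using submoduleE(1,4)[OF cM_submodule] I_carrier unfolding colon_def by blast

section \<open>Passing between the images I M and \<open>colon\<close>\<close>

text \<open>For theta = phi^-1 c, an element y is a value of theta iff phi y lies in c M, whereas y
  lies in \<open>colon\<close> iff h_a (phi y) = a y lies in c M for all a in \<open>I\<close>. So
  the image of theta lies in \<open>colon\<close>, and equality amounts to joint injectivity of the
  h_a on M / c M.\<close>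

lemma (in regular_in_ideal) endo_colon_if_endo_ideal_smult:
  assumes len: "strict_length R M cM (carrier M) len"
    and \<phi>: "module_endo R M \<phi>" "inj_on \<phi> (carrier M)" "\<phi> ` carrier M = ideal_smult R I M"
  shows "\<exists>\<theta>. module_endo R M \<theta> \<and> inj_on \<theta> (carrier M) \<and> \<theta> ` carrier M = colon"
proof -
  have "\<exists>h. module_endo R M h \<and> (\<forall>x\<in>carrier M. \<phi> (h x) = a \<odot>\<^bsub>M\<^esub> x)" if a: "a \<in> I" for a
    using ideal_smultI[OF a] by (intro endo_inj_factor[OF \<phi>(1,2) smult_endo[OF I_carrier[OF a]]]) (auto simp: \<phi>(3))
  then obtain h where h: "\<And>a. a \<in> I \<Longrightarrow> module_endo R M (h a)"
    and \<phi>h: "\<And>a x. a \<in> I \<Longrightarrow> x \<in> carrier M \<Longrightarrow> \<phi> (h a x) = a \<odot>\<^bsub>M\<^esub> x"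
    by metis
  note hc = module_endoD(1)[OF h]
  interpret C: commuting_endos R M cM "h ` I" len
  proof
    show "strict_length R M cM (carrier M) len" by (rule len)
    show "module_endo R M s" if "s \<in> h ` I" for s using that h by blast
    show "s (t x) = t (s x)" if st: "s \<in> h ` I" "t \<in> h ` I" and x: "x \<in> carrier M" for s t x
    proof -
      obtain a b where ab: "a \<in> I" "b \<in> I" "s = h a" "t = h b" using st by blast
      \<comment> \<open>Applying phi twice clears both inverses and leaves a b x on either
        side.\<close>
      have "\<phi> (\<phi> (h a (h b x))) = \<phi> (\<phi> (h b (h a x)))"
        using ab x by (simp add: \<phi>h hc I_carrier module_endoD(3)[OF \<phi>(1)] smult_commute[of a b])
      then have "\<phi> (h a (h b x)) = \<phi> (h b (h a x))"
        by (rule inj_onD[OF \<phi>(2)]) (use ab x hc module_endoD(1)[OF \<phi>(1)] in auto)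
      then have "h a (h b x) = h b (h a x)"
        by (rule inj_onD[OF \<phi>(2)]) (use ab x hc in auto)
      with ab show ?thesis by simp
    qed
  qed
  have st: "C.stable (carrier M)" "C.stable cM"
    unfolding C.stable_def
    using carrier_is_submodule cM_submodule submoduleE(1)[OF cM_submodule] hc endo_cM[OF h] by auto
  \<comment> \<open>Joint surjectivity comes from the image of phi: if \<open>N\<close> contains all
    h_a M, then phi N contains I M = phi M, so N = M.\<close>
  have key: "w \<in> cM" if w: "w \<in> carrier M" "\<And>a. a \<in> I \<Longrightarrow> h a w \<in> cM" for w
  proof (rule C.jointly_surjective_imp_jointly_injective[OF st submoduleE(1)[OF cM_submodule] _ w(1)])
    show "carrier M \<subseteq> N" if N: "submodule N R M" "\<And>s. s \<in> h ` I \<Longrightarrow> s ` carrier M \<subseteq> N" for N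
    proof
      fix y assume y: "y \<in> carrier M"
      have "ideal_smult R I M \<subseteq> \<phi> ` N"
      proof (rule ideal_smult_least[OF endo_image_submodule[OF \<phi>(1) N(1)]])
        fix a x assume ax: "a \<in> I" "x \<in> carrier M"
        then have "h a x \<in> N" using N(2) by blast
        then show "a \<odot>\<^bsub>M\<^esub> x \<in> \<phi> ` N" using \<phi>h[OF ax] by (metis imageI)
      qed
      then obtain z where z: "z \<in> N" "\<phi> y = \<phi> z" using \<phi>(3) y by blast
      then have "y = z" using \<phi>(2) y submoduleE(1)[OF N(1)] by (meson inj_onD subsetD)
      with z show "y \<in> N" by simp
    qed
    show "s w \<in> cM" if "s \<in> h ` I" for s using that w(2) by blast
  qed
  have "\<theta> ` carrier M = colon" if \<theta>: "module_endo R M \<theta>" "\<And>x. x \<in> carrier M \<Longrightarrow> \<phi> (\<theta> x) = c \<odot>\<^bsub>M\<^esub> x" for \<theta>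
  proof (intro equalityI subsetI)
    note \<theta>c = module_endoD(1)[OF \<theta>(1)]
    fix y assume "y \<in> \<theta> ` carrier M"
    then obtain x where x: "x \<in> carrier M" "y = \<theta> x" by blast
    have "a \<odot>\<^bsub>M\<^esub> y \<in> cM" if a: "a \<in> I" for a
    proof -
      \<comment> \<open>Both sides equal a c x; hence a theta x is c times h_a x.\<close>
      have "\<phi> (a \<odot>\<^bsub>M\<^esub> \<theta> x) = \<phi> (c \<odot>\<^bsub>M\<^esub> h a x)"
        using a x c_carrier
        by (simp add: module_endoD(3)[OF \<phi>(1)] \<theta> \<theta>c hc \<phi>h I_carrier smult_commute[of a c])
      then have "a \<odot>\<^bsub>M\<^esub> \<theta> x = c \<odot>\<^bsub>M\<^esub> h a x"
        by (rule inj_onD[OF \<phi>(2)]) (use a x hc \<theta>c c_carrier I_carrier in auto)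
      then show ?thesis unfolding cM_def x(2) using hc[OF a x(1)] by blast
    qed
    then show "y \<in> colon" unfolding colon_def using x \<theta>c by blast
  next
    note \<theta>c = module_endoD(1)[OF \<theta>(1)]
    fix y assume y: "y \<in> colon"
    then have yc: "y \<in> carrier M" unfolding colon_def by blast
    have "h a (\<phi> y) \<in> cM" if a: "a \<in> I" for a
    proof -
      obtain z where z: "z \<in> carrier M" "a \<odot>\<^bsub>M\<^esub> y = c \<odot>\<^bsub>M\<^esub> z"
        using y a unfolding colon_def cM_def by blast
      have "\<phi> (h a (\<phi> y)) = a \<odot>\<^bsub>M\<^esub> \<phi> y" using a yc by (simp add: \<phi>h module_endoD(1)[OF \<phi>(1)])
      also have "\<dots> = \<phi> (c \<odot>\<^bsub>M\<^esub> z)"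
        using a yc z(2) by (simp add: module_endoD(3)[OF \<phi>(1), symmetric] I_carrier)
      finally have "h a (\<phi> y) = c \<odot>\<^bsub>M\<^esub> z"
        by (rule inj_onD[OF \<phi>(2)]) (use a yc z hc module_endoD(1)[OF \<phi>(1)] c_carrier in auto)
      then show ?thesis unfolding cM_def using z(1) by blast
    qed
    then have "\<phi> y \<in> cM" by (rule key[OF module_endoD(1)[OF \<phi>(1) yc]])
    then obtain x where x: "x \<in> carrier M" "\<phi> y = c \<odot>\<^bsub>M\<^esub> x" unfolding cM_def by blast
    then have "\<phi> y = \<phi> (\<theta> x)" using \<theta>(2) by simp
    then have "y = \<theta> x" by (rule inj_onD[OF \<phi>(2)]) (use yc x \<theta>c in auto)
    then show "y \<in> \<theta> ` carrier M" using x(1) by blast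
  qed
  moreover have "inj_on \<theta> (carrier M)"
    if \<theta>: "\<And>x. x \<in> carrier M \<Longrightarrow> \<phi> (\<theta> x) = c \<odot>\<^bsub>M\<^esub> x" for \<theta>
    using regular \<theta> by (metis (mono_tags, lifting) inj_on_def)
  moreover have "\<exists>\<theta>. module_endo R M \<theta> \<and> (\<forall>x\<in>carrier M. \<phi> (\<theta> x) = c \<odot>\<^bsub>M\<^esub> x)"
    using ideal_smultI[OF cI] by (intro endo_inj_factor[OF \<phi>(1,2) smult_endo[OF c_carrier]]) (auto simp: \<phi>(3))
  ultimately show ?thesis by blast
qed

text \<open>The image of phi = theta^-1 c is \<open>W\<close>. It contains I M, because theta (a x)
  = a theta x lies in c M. If theta u = c z, then h_a u = a z, so the h_a map \<open>W\<close> into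
  I M; the inclusion of \<open>W\<close> in I M is therefore joint surjectivity of the h_a on W / c
  M.\<close>

lemma (in regular_in_ideal) endo_ideal_smult_if_endo_colon:
  assumes len: "strict_length R M cM (carrier M) len"
    and \<theta>: "module_endo R M \<theta>" "inj_on \<theta> (carrier M)" "\<theta> ` carrier M = colon"
  shows "\<exists>\<phi>. module_endo R M \<phi> \<and> inj_on \<phi> (carrier M) \<and> \<phi> ` carrier M = ideal_smult R I M"
proof -
  note \<theta>c = module_endoD(1)[OF \<theta>(1)]
  have a\<theta>: "a \<odot>\<^bsub>M\<^esub> \<theta> x \<in> cM" if "a \<in> I" "x \<in> carrier M" for a x
    using \<theta>(3) that unfolding colon_def by blast
  have "\<exists>h. module_endo R M h \<and> (\<forall>x\<in>carrier M. c \<odot>\<^bsub>M\<^esub> h x = a \<odot>\<^bsub>M\<^esub> \<theta> x)" if a: "a \<in> I" for a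
    using a\<theta>[OF a]
    by (intro endo_inj_factor[OF smult_endo[OF c_carrier] regular endo_smult_comp[OF \<theta>(1) I_carrier[OF a]]])
      (auto simp: cM_def)
  then obtain h where h: "\<And>a. a \<in> I \<Longrightarrow> module_endo R M (h a)"
    and ch: "\<And>a x. a \<in> I \<Longrightarrow> x \<in> carrier M \<Longrightarrow> c \<odot>\<^bsub>M\<^esub> h a x = a \<odot>\<^bsub>M\<^esub> \<theta> x"
    by metis
  note hc = module_endoD(1)[OF h]
  have cancel: "x = y" if "c \<odot>\<^bsub>M\<^esub> x = c \<odot>\<^bsub>M\<^esub> y" "x \<in> carrier M" "y \<in> carrier M" for x y
    using regular that by (rule inj_onD)
  have c\<theta>h: "c \<odot>\<^bsub>M\<^esub> \<theta> (h a x) = a \<odot>\<^bsub>M\<^esub> \<theta> (\<theta> x)" if "a \<in> I" "x \<in> carrier M" for a x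
    using that ch[OF that] c_carrier by (metis module_endoD(3)[OF \<theta>(1)] \<theta>c hc I_carrier)
  interpret C: commuting_endos R M cM "h ` I" len
  proof
    show "strict_length R M cM (carrier M) len" by (rule len)
    show "module_endo R M s" if "s \<in> h ` I" for s using that h by blast
    show "s (t x) = t (s x)" if st: "s \<in> h ` I" "t \<in> h ` I" and x: "x \<in> carrier M" for s t x
    proof -
      obtain a b where ab: "a \<in> I" "b \<in> I" "s = h a" "t = h b" using st by blast
      \<comment> \<open>Multiplying by c twice clears both divisions, and the right-hand side is
        symmetric in a and b.\<close>
      have *: "c \<odot>\<^bsub>M\<^esub> (c \<odot>\<^bsub>M\<^esub> h a (h b x)) = a \<odot>\<^bsub>M\<^esub> (b \<odot>\<^bsub>M\<^esub> \<theta> (\<theta> x))"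
        if "a \<in> I" "b \<in> I" for a b
        using that x c_carrier by (simp add: ch hc \<theta>c I_carrier smult_commute[of c a] c\<theta>h)
      have "c \<odot>\<^bsub>M\<^esub> (c \<odot>\<^bsub>M\<^esub> h a (h b x)) = c \<odot>\<^bsub>M\<^esub> (c \<odot>\<^bsub>M\<^esub> h b (h a x))"
        unfolding *[OF ab(1,2)] *[OF ab(2,1)]
        using ab x by (intro smult_commute) (auto simp: I_carrier \<theta>c)
      then have "c \<odot>\<^bsub>M\<^esub> h a (h b x) = c \<odot>\<^bsub>M\<^esub> h b (h a x)"
        by (rule cancel) (use ab x hc c_carrier in auto)
      then have "h a (h b x) = h b (h a x)"
        by (rule cancel) (use ab x hc in auto)
      with ab show ?thesis by simp
    qed
  qed
  \<comment> \<open>W / c M is the kernel of the map induced by theta on M / c M; the Fitting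
    argument is run on it instead of on all of M / c M.\<close>
  define W where "W = {u \<in> carrier M. \<theta> u \<in> cM}"
  have "h a u \<in> W" if a: "a \<in> I" and u: "u \<in> W" for a u
  proof -
    obtain z where z: "u \<in> carrier M" "z \<in> carrier M" "\<theta> u = c \<odot>\<^bsub>M\<^esub> z"
      using u unfolding W_def cM_def by blast
    \<comment> \<open>The outcome theta (h_a u) = a theta z lies in c M because theta z lies in
      \<open>colon\<close>; this makes \<open>W\<close> stable.\<close>
    have "c \<odot>\<^bsub>M\<^esub> \<theta> (h a u) = a \<odot>\<^bsub>M\<^esub> \<theta> (c \<odot>\<^bsub>M\<^esub> z)" using c\<theta>h[OF a z(1)] z(3) by simp
    also have "\<dots> = c \<odot>\<^bsub>M\<^esub> (a \<odot>\<^bsub>M\<^esub> \<theta> z)"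
      using a z c_carrier by (simp add: module_endoD(3)[OF \<theta>(1)] smult_commute[of a c] I_carrier \<theta>c)
    finally have "\<theta> (h a u) = a \<odot>\<^bsub>M\<^esub> \<theta> z" by (rule cancel) (use a z hc \<theta>c I_carrier in auto)
    then show ?thesis unfolding W_def using a\<theta>[OF a z(2)] hc[OF a z(1)] by simp
  qed
  moreover have cMW: "cM \<subseteq> W"
    unfolding W_def using endo_cM[OF \<theta>(1)] submoduleE(1)[OF cM_submodule] by blast
  moreover have "submodule W R M"
    unfolding W_def by (rule endo_preimage_submodule[OF \<theta>(1) carrier_is_submodule cM_submodule])
  ultimately have st: "C.stable W" "C.stable cM"
    unfolding C.stable_def using cM_submodule endo_cM[OF h] by auto
  have key: "W \<subseteq> ideal_smult R I M"
  proof (rule C.jointly_injective_imp_jointly_surjective[OF st cMW _ ideal_smult_submodule[OF I] cM_subset])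
    fix w assume w: "w \<in> W" and hw: "\<And>s. s \<in> h ` I \<Longrightarrow> s w \<in> cM"
    \<comment> \<open>If all h_a w lie in c M, then so do all a m = h_a w. Hence m lies in
      \<open>colon\<close> and is a value theta u, and cancelling theta in theta w = c theta u gives
      w = c u.\<close>
    obtain m where m: "w \<in> carrier M" "m \<in> carrier M" "\<theta> w = c \<odot>\<^bsub>M\<^esub> m"
      using w unfolding W_def cM_def by blast
    have "a \<odot>\<^bsub>M\<^esub> m \<in> cM" if a: "a \<in> I" for a
    proof -
      have "c \<odot>\<^bsub>M\<^esub> h a w = c \<odot>\<^bsub>M\<^esub> (a \<odot>\<^bsub>M\<^esub> m)"
        using a m c_carrier by (simp add: ch smult_commute[of a c] I_carrier)
      then have "h a w = a \<odot>\<^bsub>M\<^esub> m" by (rule cancel) (use a m hc I_carrier in auto)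
      then show ?thesis using hw a by (metis imageI)
    qed
    then have "m \<in> colon" unfolding colon_def using m(2) by blast
    then obtain u where u: "u \<in> carrier M" "m = \<theta> u" using \<theta>(3) by blast
    have "\<theta> w = \<theta> (c \<odot>\<^bsub>M\<^esub> u)" using m(3) u c_carrier by (simp add: module_endoD(3)[OF \<theta>(1)])
    then have "w = c \<odot>\<^bsub>M\<^esub> u" by (rule inj_onD[OF \<theta>(2)]) (use m u c_carrier in auto)
    then show "w \<in> cM" unfolding cM_def using u(1) by blast
  next
    fix s assume "s \<in> h ` I"
    then obtain a where a: "a \<in> I" "s = h a" by blast
    show "s ` W \<subseteq> ideal_smult R I M"
    proof
      fix y assume "y \<in> s ` W"
      then obtain u where u: "u \<in> W" "y = h a u" using a by blast
      obtain z where z: "u \<in> carrier M" "z \<in> carrier M" "\<theta> u = c \<odot>\<^bsub>M\<^esub> z"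
        using u(1) unfolding W_def cM_def by blast
      have "c \<odot>\<^bsub>M\<^esub> y = c \<odot>\<^bsub>M\<^esub> (a \<odot>\<^bsub>M\<^esub> z)"
        using a z u c_carrier by (simp add: ch smult_commute[of a c] I_carrier)
      then have "y = a \<odot>\<^bsub>M\<^esub> z" by (rule cancel) (use a u z hc I_carrier in auto)
      then show "y \<in> ideal_smult R I M" using ideal_smultI[OF a(1) z(2)] by simp
    qed
  qed
  have "\<exists>\<phi>. module_endo R M \<phi> \<and> (\<forall>x\<in>carrier M. \<theta> (\<phi> x) = c \<odot>\<^bsub>M\<^esub> x)"
    using cM_colon by (intro endo_inj_factor[OF \<theta>(1,2) smult_endo[OF c_carrier]]) (simp add: \<theta>(3) cM_def)
  then obtain \<phi> where \<phi>: "module_endo R M \<phi>" "\<And>x. x \<in> carrier M \<Longrightarrow> \<theta> (\<phi> x) = c \<odot>\<^bsub>M\<^esub> x" by blast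
  note \<phi>c = module_endoD(1)[OF \<phi>(1)]
  have image: "\<phi> ` carrier M = W"
  proof (intro equalityI subsetI)
    fix y assume "y \<in> \<phi> ` carrier M"
    then show "y \<in> W" unfolding W_def cM_def using \<phi>(2) \<phi>c by auto
  next
    fix y assume "y \<in> W"
    then obtain x where x: "y \<in> carrier M" "x \<in> carrier M" "\<theta> y = c \<odot>\<^bsub>M\<^esub> x"
      unfolding W_def cM_def by blast
    then have "\<theta> y = \<theta> (\<phi> x)" using \<phi>(2) by simp
    then have "y = \<phi> x" by (rule inj_onD[OF \<theta>(2)]) (use x \<phi>c in auto)
    then show "y \<in> \<phi> ` carrier M" using x(2) by blast
  qed
  have "ideal_smult R I M \<subseteq> W"
  proof (rule ideal_smult_least)
    show "submodule W R M" by (rule C.stableD(1)[OF st(1)])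
    show "a \<odot>\<^bsub>M\<^esub> x \<in> W" if "a \<in> I" "x \<in> carrier M" for a x
      using that a\<theta>[OF that] by (simp add: W_def module_endoD(3)[OF \<theta>(1)] I_carrier)
  qed
  then have "\<phi> ` carrier M = ideal_smult R I M" using image key by blast
  moreover have "inj_on \<phi> (carrier M)"
    using regular \<phi>(2) by (metis (mono_tags, lifting) inj_on_def)
  ultimately show ?thesis using \<phi>(1) by blast
qed

section \<open>Translating the two isomorphisms into endomorphisms\<close>

text \<open>The endomorphism is the inverse of the isomorphism followed by the inclusion of
  \<open>N\<close> into \<open>M\<close>.\<close>

lemma (in module) isomorphic_submodule_iff_endo:
  assumes N: "submodule N R M"
  shows "modules_isomorphic R (M\<lparr>carrier := N\<rparr>) M \<longleftrightarrow>
    (\<exists>\<phi>. module_endo R M \<phi> \<and> inj_on \<phi> (carrier M) \<and> \<phi> ` carrier M = N)"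
proof
  note Nc = submoduleE(1)[OF N, THEN subsetD]
  assume "modules_isomorphic R (M\<lparr>carrier := N\<rparr>) M"
  then obtain f where f: "f \<in> linear_maps R (M\<lparr>carrier := N\<rparr>) M" "bij_betw f N (carrier M)"
    unfolding modules_isomorphic_def by auto
  have add: "f (x \<oplus>\<^bsub>M\<^esub> y) = f x \<oplus>\<^bsub>M\<^esub> f y" if "x \<in> N" "y \<in> N" for x y
    using f(1) that by (simp add: linear_maps_def)
  have smult: "f (a \<odot>\<^bsub>M\<^esub> x) = a \<odot>\<^bsub>M\<^esub> f x" if "a \<in> carrier R" "x \<in> N" for a x
    using f(1) that by (simp add: linear_maps_def)
  define \<phi> where "\<phi> = inv_into N f"
  have bij: "bij_betw \<phi> (carrier M) N" unfolding \<phi>_def by (rule bij_betw_inv_into[OF f(2)])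
  have \<phi>N: "\<phi> x \<in> N" if "x \<in> carrier M" for x using bij that by (rule bij_betwE[rule_format])
  have f\<phi>: "f (\<phi> x) = x" if "x \<in> carrier M" for x
    unfolding \<phi>_def by (rule bij_betw_inv_into_right[OF f(2) that])
  have \<phi>f: "\<phi> (f x) = x" if "x \<in> N" for x
    unfolding \<phi>_def by (rule bij_betw_inv_into_left[OF f(2) that])
  have "module_endo R M \<phi>"
    unfolding module_endo_def
  proof (intro conjI ballI)
    show "\<phi> \<in> carrier M \<rightarrow> carrier M" using \<phi>N Nc by blast
    show "\<phi> (x \<oplus>\<^bsub>M\<^esub> y) = \<phi> x \<oplus>\<^bsub>M\<^esub> \<phi> y" if "x \<in> carrier M" "y \<in> carrier M" for x y
      using \<phi>f[OF submoduleE(5)[OF N \<phi>N[OF that(1)] \<phi>N[OF that(2)]]] that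
      by (simp add: add \<phi>N f\<phi>)
    show "\<phi> (a \<odot>\<^bsub>M\<^esub> x) = a \<odot>\<^bsub>M\<^esub> \<phi> x" if "a \<in> carrier R" "x \<in> carrier M" for a x
      using \<phi>f[OF submoduleE(4)[OF N that(1) \<phi>N[OF that(2)]]] that
      by (simp add: smult \<phi>N f\<phi>)
  qed
  with bij show "\<exists>\<phi>. module_endo R M \<phi> \<and> inj_on \<phi> (carrier M) \<and> \<phi> ` carrier M = N"
    unfolding bij_betw_def by blast
next
  assume "\<exists>\<phi>. module_endo R M \<phi> \<and> inj_on \<phi> (carrier M) \<and> \<phi> ` carrier M = N"
  then obtain \<phi> where \<phi>: "module_endo R M \<phi>" and bij: "bij_betw \<phi> (carrier M) N"
    unfolding bij_betw_def by blast
  note Nc = submoduleE(1)[OF N, THEN subsetD]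
  define g where "g = inv_into (carrier M) \<phi>"
  have gbij: "bij_betw g N (carrier M)" unfolding g_def by (rule bij_betw_inv_into[OF bij])
  have gc: "g x \<in> carrier M" if "x \<in> N" for x using gbij that by (rule bij_betwE[rule_format])
  have \<phi>g: "\<phi> (g x) = x" if "x \<in> N" for x
    unfolding g_def by (rule bij_betw_inv_into_right[OF bij that])
  have g\<phi>: "g (\<phi> x) = x" if "x \<in> carrier M" for x
    unfolding g_def by (rule bij_betw_inv_into_left[OF bij that])
  have add: "g (x \<oplus>\<^bsub>M\<^esub> y) = g x \<oplus>\<^bsub>M\<^esub> g y" if "x \<in> N" "y \<in> N" for x y
    using g\<phi>[of "g x \<oplus>\<^bsub>M\<^esub> g y"] that by (simp add: gc \<phi>g module_endoD(2)[OF \<phi>])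
  have smult: "g (a \<odot>\<^bsub>M\<^esub> x) = a \<odot>\<^bsub>M\<^esub> g x" if "a \<in> carrier R" "x \<in> N" for a x
    using g\<phi>[of "a \<odot>\<^bsub>M\<^esub> g x"] that by (simp add: gc \<phi>g module_endoD(3)[OF \<phi>])
  have "restrict g N \<in> linear_maps R (M\<lparr>carrier := N\<rparr>) M"
    unfolding linear_maps_def using gc add smult submoduleE(4,5)[OF N] by simp
  moreover have "bij_betw (restrict g N) (carrier (M\<lparr>carrier := N\<rparr>)) (carrier M)"
    using gbij by (simp add: bij_betw_restrict_eq)
  ultimately show "modules_isomorphic R (M\<lparr>carrier := N\<rparr>) M"
    unfolding modules_isomorphic_def by blast
qed

lemma (in regular_in_ideal) Hom_ideal_iff:
  "g \<in> linear_maps R ((ring_as_module R)\<lparr>carrier := I\<rparr>) M \<longleftrightarrow>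
     g \<in> I \<rightarrow>\<^sub>E carrier M \<and> (\<forall>a\<in>I. \<forall>b\<in>I. g (a \<oplus> b) = g a \<oplus>\<^bsub>M\<^esub> g b) \<and>
     (\<forall>r\<in>carrier R. \<forall>a\<in>I. g (r \<otimes> a) = r \<odot>\<^bsub>M\<^esub> g a)"
  unfolding linear_maps_def ring_as_module_def by simp

text \<open>Both sides of the second claim are g (c a). As c is regular, g c determines g through g
  a = c^-1 (a g c).\<close>

lemma (in regular_in_ideal) Hom_eval:
  assumes g: "g \<in> linear_maps R ((ring_as_module R)\<lparr>carrier := I\<rparr>) M" and a: "a \<in> I"
  shows "g a \<in> carrier M" "c \<odot>\<^bsub>M\<^esub> g a = a \<odot>\<^bsub>M\<^esub> g c"
proof -
  show "g a \<in> carrier M" using g a unfolding Hom_ideal_iff by blast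
  have "c \<odot>\<^bsub>M\<^esub> g a = g (c \<otimes> a)" using g a c_carrier unfolding Hom_ideal_iff by simp
  also have "\<dots> = g (a \<otimes> c)" using a c_carrier I_carrier by (simp add: R.m_comm)
  also have "\<dots> = a \<odot>\<^bsub>M\<^esub> g c" using g a cI I_carrier unfolding Hom_ideal_iff by simp
  finally show "c \<odot>\<^bsub>M\<^esub> g a = a \<odot>\<^bsub>M\<^esub> g c" .
qed

lemma (in regular_in_ideal) Hom_eval_inj:
  assumes "g \<in> linear_maps R ((ring_as_module R)\<lparr>carrier := I\<rparr>) M"
    and "g' \<in> linear_maps R ((ring_as_module R)\<lparr>carrier := I\<rparr>) M" and "g c = g' c"
  shows "g = g'"
proof (rule PiE_ext)
  show "g \<in> I \<rightarrow>\<^sub>E carrier M" "g' \<in> I \<rightarrow>\<^sub>E carrier M" using assms(1,2) unfolding Hom_ideal_iff by blast+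
  fix a assume a: "a \<in> I"
  have "c \<odot>\<^bsub>M\<^esub> g a = c \<odot>\<^bsub>M\<^esub> g' a" using Hom_eval(2)[OF assms(1) a] Hom_eval(2)[OF assms(2) a] assms(3) by simp
  then show "g a = g' a" by (rule inj_onD[OF regular]) (use a Hom_eval(1) assms in auto)
qed

lemma (in regular_in_ideal) Hom_eval_image:
  "(\<lambda>g. g c) ` linear_maps R ((ring_as_module R)\<lparr>carrier := I\<rparr>) M = colon"
proof (intro equalityI subsetI)
  fix y assume "y \<in> (\<lambda>g. g c) ` linear_maps R ((ring_as_module R)\<lparr>carrier := I\<rparr>) M"
  then obtain g where g: "g \<in> linear_maps R ((ring_as_module R)\<lparr>carrier := I\<rparr>) M" "y = g c" by blast
  have "a \<odot>\<^bsub>M\<^esub> y \<in> cM" if "a \<in> I" for a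
    unfolding cM_def using Hom_eval[OF g(1) that] g(2) by (metis imageI)
  then show "y \<in> colon" unfolding colon_def using Hom_eval(1)[OF g(1) cI] g(2) by simp
next
  fix y assume y: "y \<in> colon"
  have yc: "y \<in> carrier M" using y unfolding colon_def by blast
  \<comment> \<open>By \<open>Hom_eval\<close> this is the only candidate with value y at c; the
    quotient by c exists because y lies in \<open>colon\<close>.\<close>
  define g where "g = (\<lambda>a\<in>I. inv_into (carrier M) ((\<odot>\<^bsub>M\<^esub>) c) (a \<odot>\<^bsub>M\<^esub> y))"
  have gc: "g a \<in> carrier M" and cg: "c \<odot>\<^bsub>M\<^esub> g a = a \<odot>\<^bsub>M\<^esub> y" if a: "a \<in> I" for a
  proof -
    have "a \<odot>\<^bsub>M\<^esub> y \<in> (\<odot>\<^bsub>M\<^esub>) c ` carrier M" using y a unfolding colon_def cM_def by blast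
    then show "g a \<in> carrier M" "c \<odot>\<^bsub>M\<^esub> g a = a \<odot>\<^bsub>M\<^esub> y"
      using a by (simp_all add: g_def inv_into_into f_inv_into_f)
  qed
  have cancel: "x = z" if "c \<odot>\<^bsub>M\<^esub> x = c \<odot>\<^bsub>M\<^esub> z" "x \<in> carrier M" "z \<in> carrier M" for x z
    using regular that by (rule inj_onD)
  have "g (a \<oplus> b) = g a \<oplus>\<^bsub>M\<^esub> g b" if ab: "a \<in> I" "b \<in> I" for a b
  proof (rule cancel)
    have "a \<oplus> b \<in> I" using ab by (rule additive_subgroup.a_closed[OF ideal.axioms(1)[OF I]])
    then show "c \<odot>\<^bsub>M\<^esub> g (a \<oplus> b) = c \<odot>\<^bsub>M\<^esub> (g a \<oplus>\<^bsub>M\<^esub> g b)" "g (a \<oplus> b) \<in> carrier M"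
      using ab yc c_carrier by (simp_all add: cg gc smult_r_distr smult_l_distr I_carrier)
  qed (use ab gc in simp)
  moreover have "g (r \<otimes> a) = r \<odot>\<^bsub>M\<^esub> g a" if ra: "r \<in> carrier R" "a \<in> I" for r a
  proof (rule cancel)
    have "r \<otimes> a \<in> I" using ra by (intro ideal.I_l_closed[OF I])
    then show "c \<odot>\<^bsub>M\<^esub> g (r \<otimes> a) = c \<odot>\<^bsub>M\<^esub> (r \<odot>\<^bsub>M\<^esub> g a)" "g (r \<otimes> a) \<in> carrier M"
      using ra yc c_carrier by (simp_all add: cg gc smult_commute[of c r] smult_assoc1 I_carrier)
  qed (use ra gc in simp)
  moreover have "g \<in> I \<rightarrow>\<^sub>E carrier M"
  proof (rule PiE_I)
    show "g a = undefined" if "a \<notin> I" for a using that by (simp add: g_def)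
  qed (rule gc)
  ultimately have "g \<in> linear_maps R ((ring_as_module R)\<lparr>carrier := I\<rparr>) M"
    unfolding Hom_ideal_iff by blast
  moreover have "y = g c" by (rule cancel) (use cg[OF cI] gc[OF cI] yc in auto)
  ultimately show "y \<in> (\<lambda>g. g c) ` linear_maps R ((ring_as_module R)\<lparr>carrier := I\<rparr>) M" by blast
qed

text \<open>Evaluation at c is a linear bijection from the Hom module onto \<open>colon\<close>,
  along which isomorphisms are carried over in both directions.\<close>

lemma (in regular_in_ideal) isomorphic_Hom_iff_endo:
  "modules_isomorphic R M (Hom_module R ((ring_as_module R)\<lparr>carrier := I\<rparr>) M) \<longleftrightarrow>
    (\<exists>\<theta>. module_endo R M \<theta> \<and> inj_on \<theta> (carrier M) \<and> \<theta> ` carrier M = colon)"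
proof -
  let ?H = "Hom_module R ((ring_as_module R)\<lparr>carrier := I\<rparr>) M"
  define ev :: "('a \<Rightarrow> 'b) \<Rightarrow> 'b" where "ev g = g c" for g
  have H: "carrier ?H = linear_maps R ((ring_as_module R)\<lparr>carrier := I\<rparr>) M"
    by (simp add: Hom_module_def)
  have bij: "bij_betw ev (carrier ?H) colon"
    unfolding bij_betw_def H ev_def using Hom_eval_image Hom_eval_inj by (auto intro: inj_onI)
  interpret H: module R ?H
    by (rule Hom_module_module[OF R.ideal_as_module_module[OF I] module_axioms])
  have ev_add: "ev (g \<oplus>\<^bsub>?H\<^esub> g') = ev g \<oplus>\<^bsub>M\<^esub> ev g'" for g g'
    using cI by (simp add: Hom_module_def ev_def)
  have ev_smult: "ev (r \<odot>\<^bsub>?H\<^esub> g) = r \<odot>\<^bsub>M\<^esub> ev g" for r g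
    using cI by (simp add: Hom_module_def ev_def)
  have colonc: "colon \<subseteq> carrier M" unfolding colon_def by blast
  show ?thesis
  proof
    assume "modules_isomorphic R M ?H"
    then obtain f where f: "f \<in> linear_maps R M ?H" "bij_betw f (carrier M) (carrier ?H)"
      unfolding modules_isomorphic_def by blast
    have b: "bij_betw (ev \<circ> f) (carrier M) colon" by (rule bij_betw_trans[OF f(2) bij])
    have "(ev \<circ> f) x \<in> carrier M" if "x \<in> carrier M" for x
      using bij_betwE[OF b] that colonc by blast
    then have "module_endo R M (ev \<circ> f)"
      unfolding module_endo_def using f(1) by (simp add: linear_maps_def ev_add ev_smult)
    with b show "\<exists>\<theta>. module_endo R M \<theta> \<and> inj_on \<theta> (carrier M) \<and> \<theta> ` carrier M = colon"
      unfolding bij_betw_def by blast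
  next
    assume "\<exists>\<theta>. module_endo R M \<theta> \<and> inj_on \<theta> (carrier M) \<and> \<theta> ` carrier M = colon"
    then obtain \<theta> where \<theta>: "module_endo R M \<theta>" and b: "bij_betw \<theta> (carrier M) colon"
      unfolding bij_betw_def by blast
    \<comment> \<open>Members of \<open>linear_maps\<close> are \<open>undefined\<close> off the
      carrier, hence the restriction.\<close>
    define f where "f = restrict (inv_into (carrier ?H) ev \<circ> \<theta>) (carrier M)"
    have fb: "bij_betw f (carrier M) (carrier ?H)"
      unfolding f_def using bij_betw_trans[OF b bij_betw_inv_into[OF bij]]
      by (simp add: bij_betw_restrict_eq)
    have fH: "f x \<in> carrier ?H" if "x \<in> carrier M" for x using bij_betwE[OF fb] that by blast
    have evf: "ev (f x) = \<theta> x" if x: "x \<in> carrier M" for x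
      using bij_betw_inv_into_right[OF bij] bij_betwE[OF b] x by (simp add: f_def)
    have inj: "inj_on ev (carrier ?H)" using bij by (rule bij_betw_imp_inj_on)
    have "f \<in> linear_maps R M ?H"
      unfolding linear_maps_def
    proof (intro CollectI conjI ballI)
      show "f \<in> carrier M \<rightarrow>\<^sub>E carrier ?H"
      proof (rule PiE_I)
        show "f x = undefined" if "x \<notin> carrier M" for x using that by (simp add: f_def)
      qed (rule fH)
    next
      fix x y assume xy: "x \<in> carrier M" "y \<in> carrier M"
      then have "ev (f (x \<oplus>\<^bsub>M\<^esub> y)) = ev (f x \<oplus>\<^bsub>?H\<^esub> f y)"
        by (simp add: evf ev_add module_endoD(2)[OF \<theta>])
      then show "f (x \<oplus>\<^bsub>M\<^esub> y) = f x \<oplus>\<^bsub>?H\<^esub> f y"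
        by (rule inj_onD[OF inj]) (use xy fH in auto)
    next
      fix a x assume ax: "a \<in> carrier R" "x \<in> carrier M"
      then have "ev (f (a \<odot>\<^bsub>M\<^esub> x)) = ev (a \<odot>\<^bsub>?H\<^esub> f x)"
        by (simp add: evf ev_smult module_endoD(3)[OF \<theta>])
      then show "f (a \<odot>\<^bsub>M\<^esub> x) = a \<odot>\<^bsub>?H\<^esub> f x"
        by (rule inj_onD[OF inj]) (use ax fH in auto)
    qed
    with fb show "modules_isomorphic R M ?H" unfolding modules_isomorphic_def by blast
  qed
qed

section \<open>Depth one and the conclusion\<close>

text \<open>The first entry of a nonempty regular sequence is regular on \<open>M\<close> itself,
  since the empty set generates the zero ideal.\<close>

lemma (in module) regular_element_of_positive_depth:
  assumes "depth R \<mm> M = 1"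
  shows "\<exists>x\<in>\<mm> \<inter> carrier R. \<forall>y\<in>carrier M. x \<odot>\<^bsub>M\<^esub> y = \<zero>\<^bsub>M\<^esub> \<longrightarrow> y = \<zero>\<^bsub>M\<^esub>"
proof -
  let ?D = "{enat (length xs) | xs. set xs \<subseteq> \<mm> \<and> regular_sequence R M xs}"
  have sup: "Sup ?D = 1"
    using assms unfolding depth_def by (simp split: if_splits)
  \<comment> \<open>If only the empty sequence qualified, the supremum of the lengths would be
    0.\<close>
  have "\<exists>xs. set xs \<subseteq> \<mm> \<and> regular_sequence R M xs \<and> xs \<noteq> []"
  proof (rule ccontr)
    assume "\<not> ?thesis"
    then have "Sup ?D \<le> 0" by (intro Sup_least) (auto simp: zero_enat_def)
    with sup show False by simp
  qed
  then obtain xs where xs: "set xs \<subseteq> \<mm>" "regular_sequence R M xs" "xs \<noteq> []" by blast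
  have hd: "xs ! 0 \<in> set xs" using xs(3) by simp
  have "Idl {} \<subseteq> {\<zero>}" by (rule R.genideal_minimal[OF R.zeroideal]) simp
  moreover have "submodule {\<zero>\<^bsub>M\<^esub>} R M" by (rule submoduleI) auto
  ultimately have "ideal_smult R (Idl {}) M \<subseteq> {\<zero>\<^bsub>M\<^esub>}"
    by (intro ideal_smult_least) auto
  moreover have "\<zero>\<^bsub>M\<^esub> \<in> ideal_smult R (Idl {}) M"
    by (rule submodule_zero[OF ideal_smult_submodule[OF R.genideal_ideal]]) simp
  ultimately have zero: "ideal_smult R (Idl {}) M = {\<zero>\<^bsub>M\<^esub>}" by blast
  have "\<forall>y\<in>carrier M. xs ! 0 \<odot>\<^bsub>M\<^esub> y \<in> ideal_smult R (Idl (set (take 0 xs))) M \<longrightarrow>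
      y \<in> ideal_smult R (Idl (set (take 0 xs))) M"
    using xs(2,3) unfolding regular_sequence_def by blast
  then have "\<forall>y\<in>carrier M. xs ! 0 \<odot>\<^bsub>M\<^esub> y = \<zero>\<^bsub>M\<^esub> \<longrightarrow> y = \<zero>\<^bsub>M\<^esub>" by (simp add: zero)
  moreover have "xs ! 0 \<in> \<mm> \<inter> carrier R" using hd xs(1,2) unfolding regular_sequence_def by blast
  ultimately show ?thesis by blast
qed

theorem lemma3p8:
  fixes R :: "('a, 'c) ring_scheme" and \<mm> I :: "'a set"
    and M :: "('a, 'b, 'd) module_scheme"
  assumes "cohen_macaulay_local_ring R \<mm>"
    and "krull_dim R = 1"
    and "maximal_cohen_macaulay R \<mm> M"
    and "primary_to R \<mm> I"
  shows "modules_isomorphic R (M\<lparr>carrier := ideal_smult R I M\<rparr>) M \<longleftrightarrow>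
         modules_isomorphic R M (Hom_module R ((ring_as_module R)\<lparr>carrier := I\<rparr>) M)"
proof -
  have noeth: "noetherian_ring R" and loc: "local_ring R \<mm>"
    using assms(1) unfolding cohen_macaulay_local_ring_def by blast+
  have mod: "module R M" and fg: "finitely_generated_module R M"
    using assms(3) unfolding maximal_cohen_macaulay_def by blast+
  interpret module R M by (rule mod)
  have I: "ideal I R" and proper: "I \<noteq> carrier R" and rad: "radical R I = \<mm>"
    using assms(4) unfolding primary_to_def primary_ideal_def by blast+
  have I\<mm>: "I \<subseteq> \<mm>" by (rule local_ring_proper_ideal[OF noeth loc I proper])
  \<comment> \<open>The zero module has infinite depth and is treated apart; on it even 0 is
    regular.\<close>
  have "\<exists>x\<in>\<mm> \<inter> carrier R. \<forall>y\<in>carrier M. x \<odot>\<^bsub>M\<^esub> y = \<zero>\<^bsub>M\<^esub> \<longrightarrow> y = \<zero>\<^bsub>M\<^esub>"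
  proof (cases "carrier M = {\<zero>\<^bsub>M\<^esub>}")
    case True
    have "\<zero>\<^bsub>R\<^esub> \<in> I" using I by (rule additive_subgroup.zero_closed[OF ideal.axioms(1)])
    with True I\<mm> show ?thesis by (intro bexI[of _ "\<zero>\<^bsub>R\<^esub>"]) auto
  next
    case False
    with assms(2,3) have "depth R \<mm> M = 1" unfolding maximal_cohen_macaulay_def by simp
    then show ?thesis by (rule regular_element_of_positive_depth)
  qed
  then obtain x where x: "x \<in> \<mm>" "x \<in> carrier R"
    and regx: "\<And>y. y \<in> carrier M \<Longrightarrow> x \<odot>\<^bsub>M\<^esub> y = \<zero>\<^bsub>M\<^esub> \<Longrightarrow> y = \<zero>\<^bsub>M\<^esub>" by blast
  \<comment> \<open>The regular element x of \<open>\<mm>\<close> need not lie in \<open>I\<close>,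
    but a power of it does, as the radical of \<open>I\<close> is \<open>\<mm>\<close>; that power
    is again regular.\<close>
  obtain n :: nat where n: "x [^]\<^bsub>R\<^esub> n \<in> I" using x(1) rad unfolding radical_def by blast
  define c where "c = x [^]\<^bsub>R\<^esub> n"
  have c: "c \<in> carrier R" "c \<in> I" "c \<in> \<mm>" using n x(2) I\<mm> by (auto simp: c_def)
  have regc: "y = \<zero>\<^bsub>M\<^esub>" if "y \<in> carrier M" "c \<odot>\<^bsub>M\<^esub> y = \<zero>\<^bsub>M\<^esub>" for y
    using nat_pow_regular[OF x(2) regx that(1)] that(2) unfolding c_def by blast
  interpret regular_in_ideal R M I c
  proof (intro regular_in_ideal.intro regular_in_ideal_axioms.intro)
    show "inj_on ((\<odot>\<^bsub>M\<^esub>) c) (carrier M)"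
    proof (rule inj_onI)
      fix y z assume yz: "y \<in> carrier M" "z \<in> carrier M" "c \<odot>\<^bsub>M\<^esub> y = c \<odot>\<^bsub>M\<^esub> z"
      have "c \<odot>\<^bsub>M\<^esub> (y \<ominus>\<^bsub>M\<^esub> z) = \<zero>\<^bsub>M\<^esub>"
        using yz c(1) by (simp add: a_minus_def smult_r_distr smult_r_minus M.r_neg)
      then have "y \<ominus>\<^bsub>M\<^esub> z = \<zero>\<^bsub>M\<^esub>" by (rule regc[rotated]) (use yz in simp)
      then have "(y \<ominus>\<^bsub>M\<^esub> z) \<oplus>\<^bsub>M\<^esub> z = \<zero>\<^bsub>M\<^esub> \<oplus>\<^bsub>M\<^esub> z" by simp
      then show "y = z" using yz by (simp add: a_minus_def M.a_assoc M.l_neg)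
    qed
  qed (rule mod I c)+
  \<comment> \<open>M / c M has finite length: it is finitely generated over a Noetherian local ring
    and each element of \<open>\<mm>\<close> acts nilpotently on it.\<close>
  have "\<exists>len. strict_length R M cM (carrier M) len"
  proof (rule ex_strict_length[OF noeth loc fg cM_submodule])
    fix a y assume "a \<in> \<mm>" "y \<in> carrier M"
    then show "\<exists>k::nat. (a [^]\<^bsub>R\<^esub> k) \<odot>\<^bsub>M\<^esub> y \<in> cM"
      using maximal_ideal_nilpotent_mod_regular[OF noeth loc assms(2) c(3) regc] unfolding cM_def by blast
  qed
  then obtain len where len: "strict_length R M cM (carrier M) len" by blast
  show ?thesis
    unfolding isomorphic_submodule_iff_endo[OF ideal_smult_submodule[OF I]] isomorphic_Hom_iff_endo
    using endo_colon_if_endo_ideal_smult[OF len] endo_ideal_smult_if_endo_colon[OF len] by blast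
qed

end
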